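(* Let $n\ge1$ and $p>n$ be integers, let $\mathcal X$ be a measurable set, and let $(X_1,Y_1),\dots,(X_n,Y_n)\in\mathcal X\times\mathbb R$ be independent pairs with $Y_i=f(X_i)+W_i$, $1\le i\le n$, where $f:\mathcal X\to\mathbb R$ is a bounded measurable function, with $\|f\|_\infty=\sup_{x}|f(x)|$, and the design $X_1,\dots,X_n$ may be either deterministic or random (not necessarily identically distributed). Assume that $W_1,\dots,W_n$ are independent, are independent of $(X_1,\dots,X_n)$, and that there are constants $\sigma>0$, $\xi>0$ such that for every $i$: $\mathbb E W_i=0$, $\mathbb E(W_i^2)\le\sigma^2$, and $\mathbb E(|W_i|^k)\le\sigma^2k!\,\xi^{k-2}$ for all integers $k\ge3$. Let $\phi_1,\dots,\phi_p:\mathcal X\to\mathbb R$ be measurable functions with $\|\phi_j\|=1$ for every $j$ and $L=\max_{1\le j\le p}\|\phi_j\|_\infty<\infty$. Let $\alpha\in(0,1)$, $K>1$, and $$\mathcal C_1=\left[8\sigma^2+(2\|f\|_\infty+L(2K+1))^2\right]\vee\left[8\left[\xi+(2\|f\|_\infty+L(2K+1))\right]L(2K+1)\right].$$ Let $\tilde\theta_n$ be the Gibbs estimator defined in the context with $\lambda=\lambda^*=\frac{n}{2\mathcal C_1}$. Assume that $\arg\min_{\theta\in\mathbb R^p}R(\theta)\cap\Theta_K\ne\emptyset$. Then for any $\varepsilon\in(0,1)$ and any $\bar\theta\in\arg\min_{\theta\in\mathbb R^p}R(\theta)\cap\Theta_K$, with probability at least $1-\varepsilon$, $$R(\tilde\theta_n)\le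 R(\bar\theta)+\frac{3L^2}{n^2}+\frac{8\mathcal C_1}{n}\left[|J(\bar\theta)|\log(K+1)+\left(|J(\bar\theta)|\log\left(\frac{enp}{\alpha|J(\bar\theta)|}\right)+\log\left(\frac{2}{\varepsilon(1-\alpha)}\right)\right)\right],$$ where $J(\theta)=\{j:\theta_j\ne0\}$ and the terms containing $|J(\bar\theta)|$ are understood as $0$ when $J(\bar\theta)=\emptyset$.
   Context: For $g:\mathcal X\to\mathbb R$, $\|g\|_\infty=\sup_x|g(x)|$ and $\|g\|=\left(\mathbb E\left[\frac1n\sum_{i=1}^ng(X_i)^2\right]\right)^{1/2}$. For $\theta\in\mathbb R^p$, $|\theta|_1=\sum_j|\theta_j|$, $f_\theta=\sum_{j=1}^p\theta_j\phi_j$. The empirical risk is $r(\theta)=\frac1n\sum_{i=1}^n(Y_i-f_\theta(X_i))^2$. The integrated risk is $$R(\theta)=\mathbb E\left[\frac1n\sum_{i=1}^n(Y_i'-f_\theta(X_i'))^2\right],$$ where $\{(X_i',Y_i')\}_{1\le i\le n}$ is an independent copy of the sample $\{(X_i,Y_i)\}_{1\le i\le n}$; thus $R$ is a deterministic function of $\theta$, and $R(\tilde\theta_n)$ denotes this function evaluated at the random vector $\tilde\theta_n$. For $J\subset\{1,\dots,p\}$, $|J|$ is its cardinality; for $c>0$, $\Theta_c(J)=\{\theta\in\mathbb R^p:\ |\theta|_1\le c\ \text{and}\ \theta_j=0\ \text{for all } j\notin J\}$, and $\Theta_c=\Theta_c(\{1,\dots,p\})$. Prior: for $J\subset\{1,\dots,p\}$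 let $$\pi_J=\frac{\alpha^{|J|}}{\sum_{j=0}^n\alpha^j}\binom{p}{|J|}^{-1}\ \text{ if } |J|\le n,\qquad \pi_J=0\ \text{ if } |J|>n,$$ let $\mathrm u_J$ be the uniform probability measure on $\Theta_{K+1}(J)$ (normalized $|J|$-dimensional Lebesgue measure; the Dirac mass at $0$ if $J=\emptyset$), and let $\mathrm m(d\theta)=\sum_{J\subset\{1,\dots,p\}}\pi_J\,\mathrm u_J(d\theta)$, a probability measure on $\Theta_{K+1}$. Gibbs estimator: for $\lambda>0$ let $\tilde\rho_\lambda$ be the (data-dependent) probability measure on $\Theta_{K+1}$ with density $$\frac{d\tilde\rho_\lambda}{d\mathrm m}(\theta)=\frac{e^{-\lambda r(\theta)}}{\int_{\Theta_{K+1}}e^{-\lambda r}\,d\mathrm m},$$ and set $\tilde\theta_n=\tilde\theta_n(\lambda,\mathrm m)=\int_{\Theta_{K+1}}\theta\,\tilde\rho_\lambda(d\theta)$. $a\vee b$ denotes $\max(a,b)$. *)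

theory Defs
  imports "HOL-Probability.Probability"
begin

definition sup_norm :: "'x measure \<Rightarrow> ('x \<Rightarrow> real) \<Rightarrow> real" where
  "sup_norm N g = (SUP x\<in>space N. \<bar>g x\<bar>)"

definition design_norm ::
  "'w measure \<Rightarrow> nat \<Rightarrow> (nat \<Rightarrow> 'w \<Rightarrow> 'x) \<Rightarrow> ('x \<Rightarrow> real) \<Rightarrow> real" where
  "design_norm M n X g = sqrt (\<integral>\<omega>. (1 / real n) * (\<Sum>i = 1..n. (g (X i \<omega>))\<^sup>2) \<partial>M)"

definition l1_norm :: "real ^ 'p::finite \<Rightarrow> real" where
  "l1_norm \<theta> = (\<Sum>j\<in>UNIV. \<bar>\<theta> $ j\<bar>)"

definition lin_pred :: "('p::finite \<Rightarrow> 'x \<Rightarrow> real) \<Rightarrow> real ^ 'p \<Rightarrow> 'x \<Rightarrow> real" where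
  "lin_pred \<phi> \<theta> x = (\<Sum>j\<in>UNIV. \<theta> $ j * \<phi> j x)"

definition supp :: "real ^ 'p::finite \<Rightarrow> 'p set" where
  "supp \<theta> = {j. \<theta> $ j \<noteq> 0}"

definition Theta :: "real \<Rightarrow> 'p::finite set \<Rightarrow> (real ^ 'p) set" where
  "Theta c J = {\<theta>. l1_norm \<theta> \<le> c \<and> (\<forall>j. j \<notin> J \<longrightarrow> \<theta> $ j = 0)}"

text \<open>The data is the function \<open>i \<mapsto> (X\<^sub>i, Y\<^sub>i)\<close> on \<open>{1..n}\<close>, so that it is an element of the
  product space \<open>sample_space N n\<close>.\<close>

definition sample_space :: "'x measure \<Rightarrow> nat \<Rightarrow> (nat \<Rightarrow> 'x \<times> real) measure" where
  "sample_space N n = Pi\<^sub>M {1..n} (\<lambda>_. N \<Otimes>\<^sub>M borel)"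

definition sample ::
  "nat \<Rightarrow> (nat \<Rightarrow> 'w \<Rightarrow> 'x) \<Rightarrow> (nat \<Rightarrow> 'w \<Rightarrow> real) \<Rightarrow> 'w \<Rightarrow> nat \<Rightarrow> 'x \<times> real" where
  "sample n X Y \<omega> = (\<lambda>i\<in>{1..n}. (X i \<omega>, Y i \<omega>))"

definition emp_risk ::
  "('p::finite \<Rightarrow> 'x \<Rightarrow> real) \<Rightarrow> nat \<Rightarrow> (nat \<Rightarrow> 'x \<times> real) \<Rightarrow> real ^ 'p \<Rightarrow> real" where
  "emp_risk \<phi> n z \<theta> = (1 / real n) * (\<Sum>i = 1..n. (snd (z i) - lin_pred \<phi> \<theta> (fst (z i)))\<^sup>2)"

text \<open>The expectation over an independent copy of the sample is the integral with respect to the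
  joint law of the sample; lemma \<open>int_risk_copy\<close> below gives it for an explicit copy.\<close>

definition int_risk ::
  "'w measure \<Rightarrow> 'x measure \<Rightarrow> ('p::finite \<Rightarrow> 'x \<Rightarrow> real) \<Rightarrow> nat \<Rightarrow>
   (nat \<Rightarrow> 'w \<Rightarrow> 'x) \<Rightarrow> (nat \<Rightarrow> 'w \<Rightarrow> real) \<Rightarrow> real ^ 'p \<Rightarrow> real" where
  "int_risk M N \<phi> n X Y \<theta> =
     (\<integral>z. emp_risk \<phi> n z \<theta> \<partial>(distr M (sample_space N n) (sample n X Y)))"

definition prior_weight :: "real \<Rightarrow> nat \<Rightarrow> 'p::finite set \<Rightarrow> real" where
  "prior_weight \<alpha> n J =
     (if card J \<le> n
      then \<alpha> ^ card J / (\<Sum>j = 0..n. \<alpha> ^ j) * inverse (real (CARD('p) choose card J))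
      else 0)"

text \<open>Coordinates in \<open>J\<close> carry Lebesgue measure, conditioned on the \<open>\<ell>\<^sub>1\<close> ball of radius \<open>c\<close>;
  the other coordinates are set to 0. For \<open>J = {}\<close> the product space is a single point of mass 1,
  so this is the Dirac mass at 0.\<close>

definition unif :: "real \<Rightarrow> 'p::finite set \<Rightarrow> (real ^ 'p) measure" where
  "unif c J =
     distr (uniform_measure (Pi\<^sub>M J (\<lambda>_. lborel))
              {t \<in> space (Pi\<^sub>M J (\<lambda>_. lborel)). (\<Sum>j\<in>J. \<bar>t j\<bar>) \<le> c})
       borel (\<lambda>t. \<chi> j. if j \<in> J then t j else 0)"

text \<open>A measure on all of \<open>\<real>\<^sup>p\<close>, concentrated on \<open>Theta (K + 1) UNIV\<close>.\<close>

definition prior :: "real \<Rightarrow> nat \<Rightarrow> real \<Rightarrow> (real ^ 'p::finite) measure" where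
  "prior \<alpha> n K =
     measure_of UNIV (sets borel)
       (\<lambda>A. \<Sum>J\<in>UNIV. ennreal (prior_weight \<alpha> n J) * emeasure (unif (K + 1) J) A)"

definition gibbs ::
  "('p::finite \<Rightarrow> 'x \<Rightarrow> real) \<Rightarrow> nat \<Rightarrow> real \<Rightarrow> real \<Rightarrow> real \<Rightarrow> (nat \<Rightarrow> 'x \<times> real) \<Rightarrow>
   (real ^ 'p) measure" where
  "gibbs \<phi> n \<alpha> K l z =
     density (prior \<alpha> n K)
       (\<lambda>\<theta>. ennreal (exp (- l * emp_risk \<phi> n z \<theta>) /
          (LINT t:Theta (K + 1) UNIV|prior \<alpha> n K. exp (- l * emp_risk \<phi> n z t))))"

definition gibbs_est ::
  "('p::finite \<Rightarrow> 'x \<Rightarrow> real) \<Rightarrow> nat \<Rightarrow> real \<Rightarrow> real \<Rightarrow> real \<Rightarrow> (nat \<Rightarrow> 'x \<times> real) \<Rightarrow>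
   real ^ 'p" where
  "gibbs_est \<phi> n \<alpha> K l z = (LINT \<theta>:Theta (K + 1) UNIV|gibbs \<phi> n \<alpha> K l z. \<theta>)"

definition C1_const :: "real \<Rightarrow> real \<Rightarrow> real \<Rightarrow> real \<Rightarrow> real \<Rightarrow> real" where
  "C1_const \<sigma> \<xi> F L K =
     max (8 * \<sigma>\<^sup>2 + (2 * F + L * (2 * K + 1))\<^sup>2)
         (8 * (\<xi> + (2 * F + L * (2 * K + 1))) * (L * (2 * K + 1)))"

lemma sample_measurable:
  assumes "\<And>i. i \<in> {1..n} \<Longrightarrow> X i \<in> measurable M N"
    and "\<And>i. i \<in> {1..n} \<Longrightarrow> Y i \<in> borel_measurable M"
  shows "sample n X Y \<in> measurable M (sample_space N n)"
  unfolding sample_def sample_space_def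
  using assms by (intro measurable_restrict) auto

lemma emp_risk_measurable:
  assumes "\<And>j. \<phi> j \<in> borel_measurable N"
  shows "(\<lambda>z. emp_risk \<phi> n z \<theta>) \<in> borel_measurable (sample_space N n)"
proof -
  have [measurable]: "(\<lambda>z. z i) \<in> measurable (sample_space N n) (N \<Otimes>\<^sub>M borel)"
    if "i \<in> {1..n}" for i
    using that unfolding sample_space_def by (rule measurable_component_singleton)
  note [measurable] = assms
  show ?thesis unfolding emp_risk_def lin_pred_def
    by (intro borel_measurable_times borel_measurable_const borel_measurable_sum) measurable
qed

lemma int_risk_copy:
  assumes "\<And>j. \<phi> j \<in> borel_measurable N"
    and "\<And>i. i \<in> {1..n} \<Longrightarrow> X' i \<in> measurable M' N"
    and "\<And>i. i \<in> {1..n} \<Longrightarrow> Y' i \<in> borel_measurable M'"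
    and "distr M' (sample_space N n) (sample n X' Y') = distr M (sample_space N n) (sample n X Y)"
  shows "int_risk M N \<phi> n X Y \<theta> =
    (\<integral>\<omega>. (1 / real n) * (\<Sum>i = 1..n. (Y' i \<omega> - lin_pred \<phi> \<theta> (X' i \<omega>))\<^sup>2) \<partial>M')"
  unfolding int_risk_def assms(4)[symmetric]
  using integral_distr[OF sample_measurable[OF assms(2,3)] emp_risk_measurable[OF assms(1)]]
  by (simp add: emp_risk_def sample_def)

lemma emeasure_prior:
  assumes "A \<in> sets borel"
  shows "emeasure (prior \<alpha> n K :: (real ^ 'p::finite) measure) A =
    (\<Sum>J\<in>UNIV. ennreal (prior_weight \<alpha> n J) * emeasure (unif (K + 1) J) A)"
proof (rule emeasure_measure_of[OF prior_def])
  show "sets borel \<subseteq> Pow (UNIV :: (real ^ 'p) set)" by simp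
  let ?S = "sets (prior \<alpha> n K :: (real ^ 'p) measure)"
  let ?m = "\<lambda>A. \<Sum>J\<in>UNIV. ennreal (prior_weight \<alpha> n J) * emeasure (unif (K + 1) J :: (real ^ 'p) measure) A"
  have S: "?S = sets borel"
    unfolding prior_def using sets.sigma_sets_eq[of borel] by (simp add: sets_measure_of)
  show "A \<in> ?S" using assms S by simp
  show "positive ?S ?m" by (simp add: positive_def)
  show "countably_additive ?S ?m"
  proof (rule countably_additiveI)
    fix B :: "nat \<Rightarrow> (real ^ 'p) set"
    assume B: "range B \<subseteq> ?S" "disjoint_family B"
    have "(\<Sum>i. ?m (B i)) = (\<Sum>J\<in>UNIV. \<Sum>i. ennreal (prior_weight \<alpha> n J) * emeasure (unif (K + 1) J) (B i))"
      by (rule suminf_sum) simp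
    also have "\<dots> = ?m (\<Union>i. B i)"
      using B S by (intro sum.cong refl) (auto simp: ennreal_suminf_cmult unif_def intro!: arg_cong2[where f = "(*)"] suminf_emeasure)
    finally show "(\<Sum>i. ?m (B i)) = ?m (\<Union>i. B i)" .
  qed
qed

end

theory Submission
  imports Defs
begin

text \<open>The proof is PAC-Bayesian. Because \<open>\<theta>bar\<close> minimises the risk \<open>R\<close> over the whole of \<open>\<real>\<^sup>p\<close>, the
residual \<open>Y - f\<^bsub>\<theta>bar\<^esub>\<close> is orthogonal to the span of the dictionary, and Pythagoras gives
\<open>R \<theta> - R \<theta>bar = \<Delta> \<theta>\<close>, the mean square of \<open>f\<^sub>\<theta> - f\<^bsub>\<theta>bar\<^esub>\<close> along the design
(\<open>int_risk_eq_excess\<close>). Summed over the sample, the loss difference of \<open>\<theta>\<close> and \<open>\<theta>bar\<close> then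
has a second moment of at most \<open>C1\<close> times its own mean, and Bernstein's bound at \<open>\<lambda> = n / (2 * C1)\<close> yields, for every
\<open>\<theta>\<close> in the \<open>\<ell>\<^sub>1\<close> ball of radius \<open>K + 1\<close> and with \<open>r\<close> the empirical risk,
\<open>E exp (\<lambda> (\<Delta> \<theta> / 2 - (r \<theta> - r \<theta>bar))) \<le> 1\<close> and
\<open>E exp (\<lambda> ((r \<theta> - r \<theta>bar) - 3 / 2 \<Delta> \<theta>)) \<le> 1\<close> (\<open>excess_exp_moments\<close>).

Let \<open>m\<close> be the prior and \<open>S\<close> the \<open>\<ell>\<^sub>1\<close> ball of radius \<open>1 / n\<close> around \<open>\<theta>bar\<close>. The first
exponential is integrated over \<open>\<theta>\<close> with respect to \<open>m\<close>, the second with respect to \<open>m\<close>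
conditioned on \<open>S\<close>. By Tonelli and Markov, both integrals are at most \<open>2 / \<epsilon>\<close> outside an event of
probability at most \<open>\<epsilon>\<close> (\<open>mixture_exp_moment_high_prob\<close>). What remains is deterministic: Jensen's inequality
for \<open>exp\<close>, under the Gibbs measure and under the conditioned prior, bounds the Gibbs mean of \<open>\<Delta>\<close> by
\<open>3 sup\<^sub>S \<Delta> + (2 / \<lambda>) (2 ln (2 / \<epsilon>) - ln (m S))\<close> (\<open>gibbs_mean_excess_le\<close>), and by convexity \<open>\<Delta>\<close> at
the Gibbs estimator is at most that mean (\<open>excess_gibbs_est_le\<close>).

On \<open>S\<close> one has \<open>\<Delta> \<le> (L / n)\<^sup>2\<close>, the source of the term \<open>3 L\<^sup>2 / n\<^sup>2\<close>. With \<open>J\<close> the support of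
\<open>\<theta>bar\<close> and \<open>\<pi>\<^sub>J\<close> its prior weight, \<open>m S\<close> is at least \<open>\<pi>\<^sub>J\<close> times the ratio of the volumes of two
\<open>\<ell>\<^sub>1\<close> balls in dimension \<open>|J|\<close>, namely \<open>(1 / (n (K + 1)))\<^bsup>|J|\<^esup>\<close>; its negative logarithm is the
complexity term. If \<open>|J| > n\<close> the prior ignores \<open>J\<close>, but then the right-hand side exceeds
\<open>R \<theta>bar + C1\<close>, whereas \<open>\<Delta> \<le> (L (2 K + 1))\<^sup>2 \<le> C1\<close> on the whole \<open>\<ell>\<^sub>1\<close> ball.\<close>

section \<open>Exponential moments and Gibbs measures\<close>

text \<open>Beyond its linear term the exponential series has, under the moment bounds, expectations dominated
by a geometric series with ratio \<open>w * z\<close>; the inequality \<open>1 + x \<le> exp x\<close> then turns the bound on the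
sum into an exponential, which is the form that multiplies over independent variables.\<close>
lemma (in prob_space) bernstein_exp_moment:
  fixes T :: "'a \<Rightarrow> real"
  assumes T: "T \<in> borel_measurable M"
    and v: "0 \<le> v" and w: "0 \<le> w" and z: "0 \<le> z" and wz: "w * z < 1"
    and mom: "\<And>k. k \<ge> 2 \<Longrightarrow> integrable M (\<lambda>x. \<bar>T x\<bar> ^ k) \<and>
      expectation (\<lambda>x. \<bar>T x\<bar> ^ k) \<le> v * fact k * w ^ (k - 2) / 2"
  shows "(\<integral>\<^sup>+x. ennreal (exp (z * T x)) \<partial>M)
    \<le> ennreal (exp (z * expectation T + v * z\<^sup>2 / (2 * (1 - w * z))))"
proof -
  note T[measurable]
  define g where "g k x = (z * \<bar>T x\<bar>) ^ (k + 2) / fact (k + 2)" for k x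
  have g_nonneg: "0 \<le> g k x" for k x
    using z by (simp add: g_def)
  have g_int: "integrable M (g k)" for k
    using mom[of "k + 2"] unfolding g_def power_mult_distrib by simp
  have g_le: "(\<integral>x. g k x \<partial>M) \<le> v * z\<^sup>2 / 2 * (w * z) ^ k" for k
  proof -
    have "(\<integral>x. g k x \<partial>M) = z ^ (k + 2) / fact (k + 2) * expectation (\<lambda>x. \<bar>T x\<bar> ^ (k + 2))"
      unfolding g_def power_mult_distrib by simp
    also have "\<dots> \<le> z ^ (k + 2) / fact (k + 2) * (v * fact (k + 2) * w ^ (k + 2 - 2) / 2)"
      using mom[of "k + 2"] z by (intro mult_left_mono) auto
    also have "\<dots> = v * z\<^sup>2 / 2 * (w * z) ^ k"
      by (simp add: power_mult_distrib power_add power2_eq_square del: fact_Suc)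
    finally show ?thesis .
  qed
  have exp_sums: "(\<lambda>k. g k x) sums (exp (z * \<bar>T x\<bar>) - 1 - z * \<bar>T x\<bar>)" for x
  proof -
    have "(\<lambda>k. (z * \<bar>T x\<bar>) ^ k / fact k) sums exp (z * \<bar>T x\<bar>)"
      using exp_converges[of "z * \<bar>T x\<bar>"] by (simp add: divide_inverse mult.commute)
    from sums_split_initial_segment[OF this, of 2] show ?thesis
      by (simp add: g_def eval_nat_numeral algebra_simps)
  qed
  have geo: "(\<lambda>k. v * z\<^sup>2 / 2 * (w * z) ^ k) sums (v * z\<^sup>2 / 2 * (1 / (1 - w * z)))"
    using w z wz by (intro sums_mult geometric_sums) simp
  have sm: "summable (\<lambda>k. \<integral>x. norm (g k x) \<partial>M)"
    using g_nonneg g_le by (intro summable_comparison_test'[OF sums_summable[OF geo]]) simp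
  have ae: "AE x in M. summable (\<lambda>k. norm (g k x))"
    using exp_sums g_nonneg by (simp add: sums_iff)
  define G where "G x = (\<Sum>k. g k x)" for x
  have G_int: "integrable M G"
    unfolding G_def using g_int ae sm by (rule integrable_suminf)
  have "expectation G = (\<Sum>k. \<integral>x. g k x \<partial>M)"
    unfolding G_def using g_int ae sm by (rule integral_suminf)
  also have "\<dots> \<le> v * z\<^sup>2 / 2 * (1 / (1 - w * z))"
    unfolding sums_unique[OF geo]
    using sm g_nonneg g_le sums_summable[OF geo] by (intro suminf_le) auto
  finally have G_le: "expectation G \<le> v * z\<^sup>2 / (2 * (1 - w * z))" by simp
  have T_int: "integrable M T"
  proof (rule square_integrable_imp_integrable)
    show "integrable M (\<lambda>x. (T x)\<^sup>2)"
      using mom[of 2] by (simp only: power2_abs order_refl)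
  qed (rule T)
  have exp_le: "exp (z * T x) \<le> 1 + z * T x + G x" for x
  proof -
    have "(\<lambda>k. (z * T x) ^ k / fact k) sums exp (z * T x)"
      using exp_converges[of "z * T x"] by (simp add: divide_inverse mult.commute)
    from sums_split_initial_segment[OF this, of 2]
    have *: "(\<lambda>k. (z * T x) ^ (k + 2) / fact (k + 2)) sums (exp (z * T x) - 1 - z * T x)"
      by (simp add: eval_nat_numeral algebra_simps)
    have "(z * T x) ^ (k + 2) / fact (k + 2) \<le> g k x" for k
    proof -
      have "(z * T x) ^ (k + 2) \<le> \<bar>z * T x\<bar> ^ (k + 2)"
        using abs_ge_self[of "(z * T x) ^ (k + 2)"] by (simp only: power_abs)
      then show ?thesis
        unfolding g_def using z by (intro divide_right_mono) (auto simp: abs_mult)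
    qed
    from sums_le[OF this *] have "exp (z * T x) - 1 - z * T x \<le> G x"
      using exp_sums[of x] unfolding G_def by (simp add: sums_iff)
    then show ?thesis by simp
  qed
  have "(\<integral>\<^sup>+x. ennreal (exp (z * T x)) \<partial>M) \<le> (\<integral>\<^sup>+x. ennreal (1 + z * T x + G x) \<partial>M)"
    by (intro nn_integral_mono ennreal_leI exp_le)
  also have "\<dots> = ennreal (\<integral>x. 1 + z * T x + G x \<partial>M)"
    using T_int G_int exp_le by (intro nn_integral_eq_integral) (auto intro: order_trans[OF exp_ge_zero])
  also have "(\<integral>x. 1 + z * T x + G x \<partial>M) = 1 + (z * expectation T + expectation G)"
    using T_int G_int by (simp add: prob_space)
  also have "ennreal \<dots> \<le> ennreal (exp (z * expectation T + expectation G))"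
    by (intro ennreal_leI exp_ge_add_one_self)
  also have "\<dots> \<le> ennreal (exp (z * expectation T + v * z\<^sup>2 / (2 * (1 - w * z))))"
    using G_le by (intro ennreal_leI) simp
  finally show ?thesis .
qed

lemma power_add_le_two_power:
  fixes a b :: real
  assumes "0 \<le> a" "0 \<le> b"
  shows "(a + b) ^ Suc k \<le> 2 ^ k * (a ^ Suc k + b ^ Suc k)"
proof (induction k)
  case (Suc k)
  have "0 \<le> (a ^ Suc k - b ^ Suc k) * (a - b)"
  proof (cases "a \<le> b")
    case True
    with power_mono[of a b "Suc k"] assms show ?thesis by (intro mult_nonpos_nonpos) auto
  next
    case False
    with power_mono[of b a "Suc k"] assms show ?thesis by (intro mult_nonneg_nonneg) auto
  qed
  then have "(a + b) * (a ^ Suc k + b ^ Suc k) \<le> 2 * (a ^ Suc (Suc k) + b ^ Suc (Suc k))"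
    by (simp add: algebra_simps)
  then have "2 ^ k * ((a + b) * (a ^ Suc k + b ^ Suc k)) \<le> 2 ^ k * (2 * (a ^ Suc (Suc k) + b ^ Suc (Suc k)))"
    by (rule mult_left_mono) simp
  moreover have "(a + b) ^ Suc (Suc k) \<le> (a + b) * (2 ^ k * (a ^ Suc k + b ^ Suc k))"
    using mult_left_mono[OF Suc.IH, of "a + b"] assms by simp
  ultimately show ?case by (simp add: algebra_simps)
qed simp

text \<open>Jensen's inequality in several dimensions: the affine minorant that touches \<open>q\<close> at the mean
integrates to \<open>q\<close> of the mean.\<close>
lemma (in prob_space) supporting_hyperplane_mean:
  fixes Y :: "'a \<Rightarrow> 'b::euclidean_space" and q :: "'b \<Rightarrow> real"
  assumes Y: "integrable M Y" and q: "integrable M (\<lambda>x. q (Y x))" and l: "bounded_linear l"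
    and support: "\<And>y. q (expectation Y) + l (y - expectation Y) \<le> q y"
  shows "q (expectation Y) \<le> expectation (\<lambda>x. q (Y x))"
proof -
  interpret l: bounded_linear l by (fact l)
  have lY: "integrable M (\<lambda>x. l (Y x))"
    using l Y by (rule integrable_bounded_linear)
  have "q (expectation Y) = expectation (\<lambda>x. q (expectation Y) + (l (Y x) - l (expectation Y)))"
    using lY integral_bounded_linear[OF l Y] by (simp add: prob_space)
  also have "\<dots> \<le> expectation (\<lambda>x. q (Y x))"
    using support lY q by (intro integral_mono) (auto simp: l.diff)
  finally show ?thesis .
qed

text \<open>Averaging over \<open>t\<close> keeps the expectation at most 1 by Tonelli, so one application of Markov's
inequality controls all \<open>t\<close> at once; this takes the place of a union bound over parameters.\<close>
lemma mixture_exp_moment_high_prob: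
  fixes h :: "'a \<times> 'b \<Rightarrow> real"
  assumes "prob_space M" and "prob_space m"
    and h: "h \<in> borel_measurable (M \<Otimes>\<^sub>M m)"
    and mom: "AE t in m. (\<integral>\<^sup>+x. ennreal (exp (h (x, t))) \<partial>M) \<le> 1"
    and \<delta>: "0 < \<delta>"
  shows "{x \<in> space M. \<not> (\<integral>\<^sup>+t. ennreal (exp (h (x, t))) \<partial>m) \<le> ennreal (1 / \<delta>)} \<in> sets M \<and>
    measure M {x \<in> space M. \<not> (\<integral>\<^sup>+t. ennreal (exp (h (x, t))) \<partial>m) \<le> ennreal (1 / \<delta>)} \<le> \<delta>"
proof -
  interpret M: prob_space M by fact
  interpret m: prob_space m by fact
  interpret pair_sigma_finite M m ..
  note h[measurable]
  let ?u = "\<lambda>x. \<integral>\<^sup>+t. ennreal (exp (h (x, t))) \<partial>m"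
  have "(\<integral>\<^sup>+x. ?u x \<partial>M) = (\<integral>\<^sup>+t. (\<integral>\<^sup>+x. ennreal (exp (h (x, t))) \<partial>M) \<partial>m)"
    by (rule Fubini'[symmetric]) measurable
  also have "\<dots> \<le> (\<integral>\<^sup>+t. 1 \<partial>m)"
    by (rule nn_integral_mono_AE[OF mom])
  finally have le1: "(\<integral>\<^sup>+x. ?u x \<partial>M) \<le> 1"
    by (simp add: m.emeasure_space_1)
  have bad_sets: "{x \<in> space M. \<not> ?u x \<le> ennreal (1 / \<delta>)} \<in> sets M"
    by measurable
  have "{x \<in> space M. \<not> ?u x \<le> ennreal (1 / \<delta>)} \<subseteq> {x \<in> space M. 1 \<le> ennreal \<delta> * ?u x}"
  proof safe
    fix x assume "\<not> ?u x \<le> ennreal (1 / \<delta>)"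
    then have "ennreal \<delta> * ennreal (1 / \<delta>) \<le> ennreal \<delta> * ?u x"
      by (intro mult_left_mono) auto
    then show "1 \<le> ennreal \<delta> * ?u x"
      using \<delta> by (simp add: ennreal_mult[symmetric])
  qed
  then have "emeasure M {x \<in> space M. \<not> ?u x \<le> ennreal (1 / \<delta>)}
      \<le> emeasure M {x \<in> space M. 1 \<le> ennreal \<delta> * ?u x}"
    by (intro emeasure_mono) measurable
  also have "\<dots> \<le> ennreal \<delta> * (\<integral>\<^sup>+x. ?u x * indicator (space M) x \<partial>M)"
    by (rule nn_integral_Markov_inequality) measurable
  also have "\<dots> = ennreal \<delta> * (\<integral>\<^sup>+x. ?u x \<partial>M)"
    by (intro arg_cong2[where f = "(*)"] nn_integral_cong) auto
  also have "\<dots> \<le> ennreal \<delta>"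
    using mult_left_mono[OF le1, of "ennreal \<delta>"] by simp
  finally have "emeasure M {x \<in> space M. \<not> ?u x \<le> ennreal (1 / \<delta>)} \<le> ennreal \<delta>" .
  with bad_sets show ?thesis
    using \<delta> by (simp add: M.emeasure_eq_measure)
qed

lemma prob_space_gibbs_density:
  fixes m :: "'b measure" and r :: "'b \<Rightarrow> real"
  assumes m: "prob_space m" and r: "r \<in> borel_measurable m" and r_bdd: "AE t in m. \<bar>r t\<bar> \<le> Br"
  shows "prob_space (density m (\<lambda>t. ennreal (exp (- l * r t) / (\<integral>s. exp (- l * r s) \<partial>m))))"
proof -
  interpret m: prob_space m by fact
  note r[measurable]
  let ?Z = "\<integral>s. exp (- l * r s) \<partial>m"
  have lr: "AE t in m. \<bar>- l * r t\<bar> \<le> \<bar>l\<bar> * Br"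
    using r_bdd by eventually_elim (simp add: abs_mult mult_left_mono)
  have int: "integrable m (\<lambda>t. exp (- l * r t))"
    using lr by (intro m.integrable_const_bound[where B = "exp (\<bar>l\<bar> * Br)"]) auto
  have "AE t in m. exp (- (\<bar>l\<bar> * Br)) \<le> exp (- l * r t)"
    using lr by eventually_elim simp
  then have "exp (- (\<bar>l\<bar> * Br)) \<le> ?Z"
    using m.integral_ge_const[OF int] by blast
  then have Z: "0 < ?Z" by (smt (verit) exp_gt_zero)
  show ?thesis
  proof (rule prob_spaceI)
    have "emeasure (density m (\<lambda>t. ennreal (exp (- l * r t) / ?Z))) (space m)
        = (\<integral>\<^sup>+t. ennreal (exp (- l * r t) / ?Z) \<partial>m)"
      by (subst emeasure_density) (auto intro!: nn_integral_cong)
    also have "\<dots> = ennreal (\<integral>t. exp (- l * r t) / ?Z \<partial>m)"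
      using int Z by (intro nn_integral_eq_integral) auto
    also have "\<dots> = 1"
      using Z by simp
    finally show "emeasure (density m (\<lambda>t. ennreal (exp (- l * r t) / ?Z)))
        (space (density m (\<lambda>t. ennreal (exp (- l * r t) / ?Z)))) = 1" by simp
  qed
qed

text \<open>The deterministic core of the PAC-Bayesian argument, where \<open>a\<close> and \<open>b\<close> bound the two exponential
integrals and \<open>c\<close> is the empirical risk at the reference parameter. Write \<open>Z\<close> for the normalising
constant of the Gibbs density and \<open>P\<close> for \<open>m\<close> conditioned on \<open>S\<close>. Jensen under the Gibbs measure
gives \<open>l / 2 \<integral> Q \<le> ln a - l c - ln Z\<close>. Restricting the integral \<open>Z\<close> to \<open>S\<close> and applying Jensen
under \<open>P\<close> gives \<open>- ln Z \<le> - ln (m S) + l \<integral> r dP\<close>, and Jensen for the second exponential gives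
\<open>l (\<integral> r dP - c) \<le> ln b + 3 / 2 l q\<close>. The middle step is the Donsker--Varadhan variational formula
at \<open>P\<close>, whose entropy relative to \<open>m\<close> is \<open>- ln (m S)\<close>.\<close>
lemma gibbs_mean_excess_le:
  fixes m :: "'b measure" and r Q :: "'b \<Rightarrow> real"
  assumes m: "prob_space m"
    and r: "r \<in> borel_measurable m" and Q: "Q \<in> borel_measurable m"
    and r_bdd: "AE t in m. \<bar>r t\<bar> \<le> Br" and Q_bdd: "AE t in m. \<bar>Q t\<bar> \<le> BQ"
    and l: "0 < l"
    and S: "S \<in> sets m" and mS: "0 < measure m S" and Q_S: "\<And>t. t \<in> S \<Longrightarrow> Q t \<le> q"
    and a: "0 < a" and b: "0 < b"
    and upper: "(\<integral>\<^sup>+t. ennreal (exp (l * (Q t / 2 - (r t - c)))) \<partial>m) \<le> ennreal a"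
    and lower: "(\<integral>\<^sup>+t. ennreal (exp (l * ((r t - c) - 3 / 2 * Q t))) \<partial>uniform_measure m S) \<le> ennreal b"
  shows "(\<integral>t. Q t \<partial>density m (\<lambda>t. ennreal (exp (- l * r t) / (\<integral>s. exp (- l * r s) \<partial>m))))
    \<le> 3 * q + 2 / l * (ln a + ln b - ln (measure m S))"
proof -
  interpret m: prob_space m by fact
  note r[measurable] Q[measurable] S[measurable]
  have bounded_int: "integrable m (\<lambda>t. F (r t) (Q t))"
    if [measurable]: "(\<lambda>t. F (r t) (Q t)) \<in> borel_measurable m"
      and "\<And>x y. \<bar>x\<bar> \<le> Br \<Longrightarrow> \<bar>y\<bar> \<le> BQ \<Longrightarrow> \<bar>F x y\<bar> \<le> B" for F :: "real \<Rightarrow> real \<Rightarrow> real" and B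
    using r_bdd Q_bdd that(2) by (intro m.integrable_const_bound[where B = B]) auto
  have exp_int: "integrable m (\<lambda>t. exp (u * r t + v * Q t + w))" for u v w
  proof (rule bounded_int[of "\<lambda>x y. exp (u * x + v * y + w)" "exp (\<bar>u\<bar> * Br + \<bar>v\<bar> * BQ + \<bar>w\<bar>)"])
    fix x y :: real assume "\<bar>x\<bar> \<le> Br" "\<bar>y\<bar> \<le> BQ"
    then have "\<bar>u * x\<bar> \<le> \<bar>u\<bar> * Br" "\<bar>v * y\<bar> \<le> \<bar>v\<bar> * BQ"
      by (auto simp: abs_mult intro: mult_left_mono)
    then show "\<bar>exp (u * x + v * y + w)\<bar> \<le> exp (\<bar>u\<bar> * Br + \<bar>v\<bar> * BQ + \<bar>w\<bar>)"
      by simp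
  qed measurable
  have r_int: "integrable m r" and Q_int: "integrable m Q"
    using bounded_int[of "\<lambda>x y. x" Br] bounded_int[of "\<lambda>x y. y" BQ] by auto
  define Z where "Z = (\<integral>s. exp (- l * r s) \<partial>m)"
  have Z_int: "integrable m (\<lambda>t. exp (- l * r t))"
    using exp_int[of "- l" 0 0] by simp
  define P where "P = uniform_measure m S"
  have emS: "emeasure m S \<noteq> 0" "emeasure m S \<noteq> \<infinity>"
    using mS by (auto simp: m.emeasure_eq_measure)
  interpret P: prob_space P
    unfolding P_def using emS by (rule prob_space_uniform_measure)
  have P_dens: "P = density m (\<lambda>t. ennreal (indicator S t / measure m S))"
    unfolding P_def uniform_measure_def using mS
    by (intro density_cong)
       (auto simp: m.emeasure_eq_measure divide_ennreal[symmetric] ennreal_indicator)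
  have P_integral: "(\<integral>t. F t \<partial>P) = (\<integral>t. indicator S t * F t \<partial>m) / measure m S"
    if [measurable]: "F \<in> borel_measurable m" for F :: "'b \<Rightarrow> real"
  proof -
    have "(\<integral>t. F t \<partial>P) = (\<integral>t. (indicator S t / measure m S) *\<^sub>R F t \<partial>m)"
      unfolding P_dens by (rule integral_density) auto
    then show ?thesis by simp
  qed
  have P_integrable: "integrable P F" if "integrable m F" for F :: "'b \<Rightarrow> real"
  proof -
    have [measurable]: "F \<in> borel_measurable m" using that by simp
    have "integrable m (\<lambda>t. (indicator S t / measure m S) *\<^sub>R F t)"
      using integrable_mult_indicator[OF S that] by simp
    then show ?thesis unfolding P_dens by (subst integrable_density) auto
  qed
  have sets_P[measurable_cong]: "sets P = sets m" unfolding P_def by simp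
  have Z_ge: "measure m S * exp (- l * (\<integral>t. r t \<partial>P)) \<le> Z"
  proof -
    have "exp (\<integral>t. - l * r t \<partial>P) \<le> (\<integral>t. exp (- l * r t) \<partial>P)"
      using P_integrable[OF Z_int] P_integrable[OF r_int] exp_convex
      by (intro P.jensens_inequality[where I = UNIV]) auto
    also have "\<dots> = (\<integral>t. indicator S t * exp (- l * r t) \<partial>m) / measure m S"
      by (rule P_integral) measurable
    also have "\<dots> \<le> Z / measure m S"
      unfolding Z_def using integrable_mult_indicator[OF S Z_int] Z_int mS
      by (intro divide_right_mono integral_mono) (auto simp: indicator_def)
    finally show ?thesis using mS by (simp add: field_simps)
  qed
  then have Z_pos: "0 < Z" using mS by (smt (verit) exp_gt_zero mult_pos_pos)
  have r_P: "integrable P r" and Q_P: "integrable P Q"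
    using r_int Q_int by (auto intro: P_integrable)
  have lower': "l * ((\<integral>t. r t \<partial>P) - c) - 3 / 2 * l * q \<le> ln b"
  proof -
    let ?h = "\<lambda>t. l * ((r t - c) - 3 / 2 * Q t)"
    have h_eq: "?h = (\<lambda>t. l * r t + (- 3 / 2 * l) * Q t + (- l * c))"
      by (auto simp: algebra_simps)
    have h_P: "integrable P ?h"
      unfolding h_eq using r_P Q_P by auto
    have exp_h_P: "integrable P (\<lambda>t. exp (?h t))"
      using P_integrable[OF exp_int[of l "- 3 / 2 * l" "- l * c"]] by (simp add: algebra_simps)
    have "(\<integral>t. Q t \<partial>P) \<le> (\<integral>t. q \<partial>P)"
      using Q_P Q_S unfolding P_def
      by (intro integral_mono_AE AE_uniform_measureI) (auto simp: P_def[symmetric])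
    then have "l * ((\<integral>t. r t \<partial>P) - c) - 3 / 2 * l * q \<le> l * ((\<integral>t. r t \<partial>P) - c) - 3 / 2 * l * (\<integral>t. Q t \<partial>P)"
      using l by (simp add: P.prob_space)
    also have "\<dots> = (\<integral>t. ?h t \<partial>P)"
      unfolding h_eq using r_P Q_P by (simp add: P.prob_space algebra_simps)
    finally have "exp (l * ((\<integral>t. r t \<partial>P) - c) - 3 / 2 * l * q) \<le> exp (\<integral>t. ?h t \<partial>P)"
      by simp
    also have "\<dots> \<le> (\<integral>t. exp (?h t) \<partial>P)"
      using h_P exp_h_P exp_convex by (intro P.jensens_inequality[where I = UNIV]) auto
    also have "\<dots> \<le> b"
      using lower b exp_h_P by (subst (asm) P_def[symmetric]) (simp add: nn_integral_eq_integral)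
    finally show ?thesis
      using b by (simp add: ln_ge_iff)
  qed
  define D where "D = density m (\<lambda>t. ennreal (exp (- l * r t) / Z))"
  have D_integral: "(\<integral>t. F t \<partial>D) = (\<integral>t. exp (- l * r t) * F t \<partial>m) / Z"
    if [measurable]: "F \<in> borel_measurable m" for F :: "'b \<Rightarrow> real"
  proof -
    have "(\<integral>t. F t \<partial>D) = (\<integral>t. (exp (- l * r t) / Z) *\<^sub>R F t \<partial>m)"
      unfolding D_def using Z_pos by (intro integral_density) auto
    then show ?thesis by simp
  qed
  have D_integrable: "integrable D F"
    if "integrable m (\<lambda>t. exp (- l * r t) * F t)" and [measurable]: "F \<in> borel_measurable m"
    for F :: "'b \<Rightarrow> real"
    unfolding D_def using that Z_pos by (subst integrable_density) auto
  interpret D: prob_space D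
    unfolding D_def Z_def by (rule prob_space_gibbs_density[OF m r r_bdd])
  have "integrable m (\<lambda>t. exp (- l * r t) * Q t)"
  proof (rule bounded_int[of "\<lambda>x y. exp (- l * x) * y" "exp (l * Br) * BQ"])
    fix x y :: real assume "\<bar>x\<bar> \<le> Br" "\<bar>y\<bar> \<le> BQ"
    moreover from this have "l * (- x) \<le> l * Br"
      using l by (intro mult_left_mono) auto
    ultimately show "\<bar>exp (- l * x) * y\<bar> \<le> exp (l * Br) * BQ"
      unfolding abs_mult by (intro mult_mono) auto
  qed measurable
  then have Q_D: "integrable D Q"
    by (rule D_integrable) measurable
  have exp_split: "exp (- l * r t) * exp (l / 2 * Q t) = exp (- l * c) * exp (l * (Q t / 2 - (r t - c)))" for t
    by (simp add: exp_add[symmetric] algebra_simps)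
  have exp_int': "integrable m (\<lambda>t. exp (l * (Q t / 2 - (r t - c))))"
    using exp_int[of "- l" "l / 2" "l * c"] by (simp add: algebra_simps)
  have "exp (\<integral>t. l / 2 * Q t \<partial>D) \<le> (\<integral>t. exp (l / 2 * Q t) \<partial>D)"
  proof (rule D.jensens_inequality[where I = UNIV])
    show "integrable D (\<lambda>t. exp (l / 2 * Q t))"
      using exp_int' by (intro D_integrable, unfold exp_split) auto
  qed (use Q_D exp_convex in auto)
  also have "\<dots> = exp (- l * c) * (\<integral>t. exp (l * (Q t / 2 - (r t - c))) \<partial>m) / Z"
    by (subst D_integral, measurable) (simp only: exp_split integral_mult_right_zero)
  also have "(\<integral>t. exp (l * (Q t / 2 - (r t - c))) \<partial>m) \<le> a"
    using upper a exp_int' by (simp add: nn_integral_eq_integral)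
  finally have "exp (l / 2 * (\<integral>t. Q t \<partial>D)) \<le> exp (- l * c) * a / Z"
    using Z_pos by (simp add: divide_right_mono mult_left_mono)
  then have "l / 2 * (\<integral>t. Q t \<partial>D) \<le> ln (exp (- l * c) * a / Z)"
    using Z_pos a by (subst ln_ge_iff) auto
  also have "\<dots> = - l * c + ln a - ln Z"
    using Z_pos a by (simp add: ln_div ln_mult)
  finally have "l / 2 * (\<integral>t. Q t \<partial>D) \<le> - l * c + ln a - ln Z" .
  moreover have "ln (measure m S) - l * (\<integral>t. r t \<partial>P) \<le> ln Z"
  proof -
    have "ln (measure m S * exp (- l * (\<integral>t. r t \<partial>P))) \<le> ln Z"
      using Z_ge Z_pos mS by (subst ln_le_cancel_iff) auto
    then show ?thesis using mS by (simp add: ln_mult)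
  qed
  ultimately have "l / 2 * (\<integral>t. Q t \<partial>D) \<le> ln a + ln b - ln (measure m S) + 3 / 2 * l * q"
    using lower' by (simp add: algebra_simps)
  then have "(\<integral>t. Q t \<partial>D) \<le> (ln a + ln b - ln (measure m S) + 3 / 2 * l * q) / (l / 2)"
    using l by (simp add: field_simps)
  also have "\<dots> = 3 * q + 2 / l * (ln a + ln b - ln (measure m S))"
    using l by (simp add: field_simps)
  finally show ?thesis unfolding D_def Z_def .
qed

section \<open>Volumes of \<open>\<ell>\<^sub>1\<close> balls\<close>

text \<open>Both sides are measures in \<open>B\<close>, and they agree on boxes by the affine change of variables on the
line, one coordinate at a time.\<close>
lemma emeasure_PiM_lborel_affine:
  fixes a :: "'i \<Rightarrow> real"
  assumes J: "finite J" and c: "0 < c" and B: "B \<in> sets (Pi\<^sub>M J (\<lambda>_. lborel))"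
  shows "emeasure (Pi\<^sub>M J (\<lambda>_. lborel)) B = ennreal (c ^ card J) *
    emeasure (Pi\<^sub>M J (\<lambda>_. lborel)) ((\<lambda>t. \<lambda>j\<in>J. a j + c * t j) -` B \<inter> space (Pi\<^sub>M J (\<lambda>_. lborel)))"
proof -
  interpret product_sigma_finite "\<lambda>_. lborel :: real measure" ..
  let ?L = "Pi\<^sub>M J (\<lambda>_. lborel :: real measure)"
  let ?g = "\<lambda>t. \<lambda>j\<in>J. a j + c * t j"
  have g[measurable]: "?g \<in> measurable ?L ?L"
    by (intro measurable_restrict) simp
  define P where "P = density (distr ?L ?L ?g) (\<lambda>_. ennreal (c ^ card J))"
  have P_eq: "emeasure P C = ennreal (c ^ card J) * emeasure ?L (?g -` C \<inter> space ?L)"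
    if "C \<in> sets ?L" for C
    using that unfolding P_def by (simp add: emeasure_density_const emeasure_distr)
  have "P = ?L"
  proof (rule PiM_eqI[OF J])
    show "sets P = sets ?L" by (simp add: P_def)
    fix A :: "'i \<Rightarrow> real set" assume A: "\<And>i. i \<in> J \<Longrightarrow> A i \<in> sets lborel"
    have pre: "?g -` Pi\<^sub>E J A \<inter> space ?L = Pi\<^sub>E J (\<lambda>j. (\<lambda>x. a j + c * x) -` A j)"
      by (auto simp: space_PiM PiE_iff extensional_def)
    have pre_meas: "(\<lambda>x. a j + c * x) -` A j \<in> sets lborel" if "j \<in> J" for j
      using measurable_sets[of "\<lambda>x. a j + c * x" borel borel "A j"] A[OF that] by simp
    have one: "emeasure lborel (A j) = ennreal c * emeasure lborel ((\<lambda>x. a j + c * x) -` A j)"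
      if "j \<in> J" for j
      using A[OF that] c
      by (subst lborel_real_affine[of c "a j"]) (simp_all add: emeasure_density_const emeasure_distr)
    have "emeasure P (Pi\<^sub>E J A) = ennreal (c ^ card J) * emeasure ?L (?g -` Pi\<^sub>E J A \<inter> space ?L)"
      using A J by (intro P_eq sets_PiM_I_finite) auto
    also have "\<dots> = ennreal (c ^ card J) * (\<Prod>j\<in>J. emeasure lborel ((\<lambda>x. a j + c * x) -` A j))"
      unfolding pre using pre_meas J by (subst emeasure_PiM) auto
    also have "\<dots> = (\<Prod>j\<in>J. emeasure lborel (A j))"
      using c one by (simp add: prod.distrib ennreal_power)
    finally show "emeasure P (Pi\<^sub>E J A) = (\<Prod>j\<in>J. emeasure lborel (A j))" .
  qed
  then show ?thesis using P_eq[OF B] by simp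
qed

definition l1_ball :: "'i set \<Rightarrow> ('i \<Rightarrow> real) \<Rightarrow> real \<Rightarrow> ('i \<Rightarrow> real) set" where
  "l1_ball J a r = {t \<in> space (Pi\<^sub>M J (\<lambda>_. lborel)). (\<Sum>j\<in>J. \<bar>t j - a j\<bar>) \<le> r}"

lemma l1_ball_sets: "l1_ball J a r \<in> sets (Pi\<^sub>M J (\<lambda>_. lborel))"
proof -
  have [measurable]: "(\<lambda>t. t j) \<in> borel_measurable (Pi\<^sub>M J (\<lambda>_. lborel))" if "j \<in> J" for j
    using measurable_component_singleton[OF that, of "\<lambda>_. lborel"] by simp
  show ?thesis unfolding l1_ball_def by measurable
qed

text \<open>Only the ratio of two volumes is ever needed, so the translation and dilation that map one ball
to the other replace the computation of the volume of the unit ball.\<close>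
lemma emeasure_l1_ball_scale:
  assumes J: "finite J" and r: "0 < r" and s: "0 < s"
  shows "emeasure (Pi\<^sub>M J (\<lambda>_. lborel)) (l1_ball J a r) =
    ennreal ((r / s) ^ card J) * emeasure (Pi\<^sub>M J (\<lambda>_. lborel)) (l1_ball J (\<lambda>_. 0) s)"
proof -
  have "(\<lambda>t. \<lambda>j\<in>J. a j + r / s * t j) -` l1_ball J a r \<inter> space (Pi\<^sub>M J (\<lambda>_. lborel))
      = l1_ball J (\<lambda>_. 0) s"
  proof -
    have "(\<Sum>j\<in>J. \<bar>(\<lambda>j\<in>J. a j + r / s * t j) j - a j\<bar>) = r / s * (\<Sum>j\<in>J. \<bar>t j\<bar>)" for t
      using r s by (simp add: abs_mult sum_distrib_left)
    moreover have "r / s * x \<le> r \<longleftrightarrow> x \<le> s" for x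
      using r s by (simp add: field_simps)
    ultimately show ?thesis
      by (auto simp: l1_ball_def space_PiM simp del: restrict_apply)
  qed
  then show ?thesis
    using emeasure_PiM_lborel_affine[OF J _ l1_ball_sets, where c = "r / s" and a = a] r s by simp
qed

lemma emeasure_l1_ball_finite:
  assumes J: "finite J"
  shows "emeasure (Pi\<^sub>M J (\<lambda>_. lborel)) (l1_ball J (\<lambda>_. 0) r) \<noteq> \<infinity>"
proof -
  interpret product_sigma_finite "\<lambda>_. lborel :: real measure" ..
  have "\<bar>t j\<bar> \<le> r" if "(\<Sum>j\<in>J. \<bar>t j\<bar>) \<le> r" "j \<in> J" for t :: "'a \<Rightarrow> real" and j
    using member_le_sum[of j J "\<lambda>j. \<bar>t j\<bar>"] J that by auto
  then have "l1_ball J (\<lambda>_. 0) r \<subseteq> Pi\<^sub>E J (\<lambda>_. {- r..r})"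
    unfolding l1_ball_def space_PiM by (auto simp: PiE_iff abs_le_iff minus_le_iff extensional_def)
  then have "emeasure (Pi\<^sub>M J (\<lambda>_. lborel)) (l1_ball J (\<lambda>_. 0) r)
      \<le> emeasure (Pi\<^sub>M J (\<lambda>_. lborel)) (Pi\<^sub>E J (\<lambda>_. {- r..r}))"
    by (rule emeasure_mono) (rule sets_PiM_I_finite[OF J], simp)
  also have "\<dots> < \<infinity>"
    using J by (subst emeasure_PiM) (auto simp: emeasure_lborel_Icc_eq ennreal_power[symmetric] power_less_top_ennreal)
  finally show ?thesis by simp
qed

lemma emeasure_l1_ball_pos:
  assumes J: "finite J" and r: "0 < r"
  shows "emeasure (Pi\<^sub>M J (\<lambda>_. lborel)) (l1_ball J (\<lambda>_. 0) r) \<noteq> 0"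
proof -
  interpret product_sigma_finite "\<lambda>_. lborel :: real measure" ..
  \<comment> \<open>The cube of half-side \<open>?e\<close> lies in the ball; adding 1 covers the empty index set.\<close>
  let ?e = "r / (real (card J) + 1)"
  have e: "0 < ?e" using r by simp
  have "(\<Sum>j\<in>J. \<bar>t j\<bar>) \<le> r" if "\<And>j. j \<in> J \<Longrightarrow> \<bar>t j\<bar> \<le> ?e" for t :: "'a \<Rightarrow> real"
  proof -
    have "(\<Sum>j\<in>J. \<bar>t j\<bar>) \<le> real (card J) * ?e"
      using sum_bounded_above[of J "\<lambda>j. \<bar>t j\<bar>" ?e] that by simp
    also have "\<dots> \<le> r" using r by (simp add: field_simps)
    finally show ?thesis .
  qed
  then have "Pi\<^sub>E J (\<lambda>_. {- ?e..?e}) \<subseteq> l1_ball J (\<lambda>_. 0) r"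
    by (auto simp: l1_ball_def space_PiM PiE_iff abs_le_iff minus_le_iff)
  then have "emeasure (Pi\<^sub>M J (\<lambda>_. lborel)) (Pi\<^sub>E J (\<lambda>_. {- ?e..?e}))
      \<le> emeasure (Pi\<^sub>M J (\<lambda>_. lborel)) (l1_ball J (\<lambda>_. 0) r)"
    using l1_ball_sets by (intro emeasure_mono)
  moreover have "emeasure (Pi\<^sub>M J (\<lambda>_. lborel)) (Pi\<^sub>E J (\<lambda>_. {- ?e..?e})) \<noteq> 0"
    using J e by (subst emeasure_PiM) (auto simp: emeasure_lborel_Icc_eq)
  ultimately show ?thesis by auto
qed

section \<open>The sparsity prior\<close>

lemma borel_measurable_vec_iff:
  fixes g :: "'a \<Rightarrow> real ^ 'n::finite"
  shows "g \<in> borel_measurable M \<longleftrightarrow> (\<forall>j. (\<lambda>x. g x $ j) \<in> borel_measurable M)"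
  by (subst borel_measurable_euclidean_space) (auto simp: Basis_vec_def inner_axis)

lemma borel_measurable_vec_nth [measurable]:
  "(\<lambda>\<theta>. \<theta> $ j) \<in> borel_measurable (borel :: (real ^ 'n::finite) measure)"
  using borel_measurable_vec_iff[of "\<lambda>\<theta>. \<theta>" borel] by simp

lemma l1_norm_measurable [measurable]: "l1_norm \<in> borel_measurable borel"
  unfolding l1_norm_def by measurable

lemma l1_nbhd_sets [measurable]: "{\<theta>. l1_norm (\<theta> - b) \<le> \<delta>} \<in> sets borel"
proof -
  have "{\<theta> \<in> space borel. l1_norm (\<theta> - b) \<le> \<delta>} \<in> sets borel" by measurable
  then show ?thesis by simp
qed

lemma Theta_UNIV: "Theta c UNIV = {\<theta>. l1_norm \<theta> \<le> c}"
  by (simp add: Theta_def)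

lemma Theta_sets [measurable]: "Theta c UNIV \<in> sets borel"
  using l1_nbhd_sets[of 0 c] by (simp add: Theta_UNIV)

lemma extend_by_zero_measurable [measurable]:
  "(\<lambda>t. \<chi> j. if j \<in> J then t j else 0) \<in> borel_measurable (Pi\<^sub>M J (\<lambda>_. lborel :: real measure))"
proof (subst borel_measurable_vec_iff, intro allI)
  fix j
  show "(\<lambda>t. (\<chi> j. if j \<in> J then t j else 0) $ j) \<in> borel_measurable (Pi\<^sub>M J (\<lambda>_. lborel :: real measure))"
    using measurable_component_singleton[of j J "\<lambda>_. lborel :: real measure"] by (cases "j \<in> J") auto
qed

lemma sets_unif [measurable_cong]: "sets (unif c J) = sets borel"
  by (simp add: unif_def)

context
  fixes J :: "'p::finite set" and c :: real
  assumes c: "0 < c"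
begin

lemma unif_eq:
  "unif c J = distr (uniform_measure (Pi\<^sub>M J (\<lambda>_. lborel)) (l1_ball J (\<lambda>_. 0) c)) borel
     (\<lambda>t. \<chi> j. if j \<in> J then t j else 0)"
  by (simp add: unif_def l1_ball_def)

lemma prob_space_unif: "prob_space (unif c J)"
proof -
  interpret P: prob_space "uniform_measure (Pi\<^sub>M J (\<lambda>_. lborel :: real measure)) (l1_ball J (\<lambda>_. 0) c)"
    using emeasure_l1_ball_pos[of J c] emeasure_l1_ball_finite[of J c] c
    by (intro prob_space_uniform_measure) auto
  show ?thesis unfolding unif_eq by (intro P.prob_space_distr) simp
qed

lemma emeasure_unif:
  assumes "A \<in> sets borel"
  shows "emeasure (unif c J) A = emeasure (Pi\<^sub>M J (\<lambda>_. lborel))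
      {t \<in> l1_ball J (\<lambda>_. 0) c. (\<chi> j. if j \<in> J then t j else 0) \<in> A}
    / emeasure (Pi\<^sub>M J (\<lambda>_. lborel)) (l1_ball J (\<lambda>_. 0) c)"
proof -
  let ?L = "Pi\<^sub>M J (\<lambda>_. lborel :: real measure)" and ?B = "l1_ball J (\<lambda>_. 0) c"
  let ?g = "\<lambda>t. \<chi> j. if j \<in> J then t j else (0::real)"
  have "emeasure (unif c J) A = emeasure (uniform_measure ?L ?B) (?g -` A \<inter> space ?L)"
    unfolding unif_eq using assms by (subst emeasure_distr) auto
  also have "\<dots> = emeasure ?L (?B \<inter> (?g -` A \<inter> space ?L)) / emeasure ?L ?B"
    using assms l1_ball_sets
    by (intro emeasure_uniform_measure) (auto intro: measurable_sets[OF extend_by_zero_measurable])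
  also have "?B \<inter> (?g -` A \<inter> space ?L) = {t \<in> ?B. ?g t \<in> A}"
    by (auto simp: l1_ball_def)
  finally show ?thesis .
qed

lemma l1_norm_extend_by_zero:
  assumes "\<And>j. j \<notin> J \<Longrightarrow> b $ j = 0"
  shows "l1_norm ((\<chi> j. if j \<in> J then t j else 0) - b) = (\<Sum>j\<in>J. \<bar>t j - b $ j\<bar>)"
  unfolding l1_norm_def using assms by (intro sum.mono_neutral_cong_right) auto

lemma emeasure_unif_Theta: "emeasure (unif c J) (Theta c UNIV) = 1"
proof -
  have "{t \<in> l1_ball J (\<lambda>_. 0) c. (\<chi> j. if j \<in> J then t j else 0) \<in> Theta c UNIV} = l1_ball J (\<lambda>_. 0) c"
    using l1_norm_extend_by_zero[of 0] by (auto simp: l1_ball_def Theta_UNIV)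
  then show ?thesis
    using emeasure_l1_ball_pos[of J c] emeasure_l1_ball_finite[of J c] c
    by (simp add: emeasure_unif ennreal_divide_self top.not_eq_extremum)
qed

text \<open>The hypothesis on \<open>l1_norm b + \<delta>\<close> puts the small ball inside the support of the uniform measure,
so its mass is a ratio of volumes.\<close>
lemma emeasure_unif_l1_nbhd:
  assumes b: "\<And>j. j \<notin> J \<Longrightarrow> b $ j = 0" and \<delta>: "0 < \<delta>" and room: "l1_norm b + \<delta> \<le> c"
  shows "emeasure (unif c J) {\<theta>. l1_norm (\<theta> - b) \<le> \<delta>} = ennreal ((\<delta> / c) ^ card J)"
proof -
  let ?L = "Pi\<^sub>M J (\<lambda>_. lborel :: real measure)"
  have sub: "(\<Sum>j\<in>J. \<bar>t j\<bar>) \<le> c" if "(\<Sum>j\<in>J. \<bar>t j - b $ j\<bar>) \<le> \<delta>" for t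
  proof -
    have "(\<Sum>j\<in>J. \<bar>t j\<bar>) \<le> (\<Sum>j\<in>J. \<bar>t j - b $ j\<bar> + \<bar>b $ j\<bar>)"
      by (intro sum_mono) auto
    moreover have "(\<Sum>j\<in>J. \<bar>b $ j\<bar>) \<le> l1_norm b"
      unfolding l1_norm_def by (intro sum_mono2) auto
    ultimately show ?thesis
      using that room by (simp add: sum.distrib)
  qed
  have "{t \<in> l1_ball J (\<lambda>_. 0) c. (\<chi> j. if j \<in> J then t j else 0) \<in> {\<theta>. l1_norm (\<theta> - b) \<le> \<delta>}}
      = l1_ball J (\<lambda>j. b $ j) \<delta>"
    using l1_norm_extend_by_zero[OF b] sub by (auto simp: l1_ball_def)
  then have "emeasure (unif c J) {\<theta>. l1_norm (\<theta> - b) \<le> \<delta>}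
      = emeasure ?L (l1_ball J (\<lambda>j. b $ j) \<delta>) / emeasure ?L (l1_ball J (\<lambda>_. 0) c)"
    by (simp add: emeasure_unif)
  also have "\<dots> = ennreal ((\<delta> / c) ^ card J)"
    using emeasure_l1_ball_pos[of J c] emeasure_l1_ball_finite[of J c] c
      emeasure_l1_ball_scale[of J \<delta> c "\<lambda>j. b $ j"] \<delta>
    by (simp add: ennreal_times_divide[symmetric] ennreal_divide_self top.not_eq_extremum)
  finally show ?thesis .
qed

end

lemma prior_weight_nonneg: "0 < \<alpha> \<Longrightarrow> 0 \<le> prior_weight \<alpha> n J"
  by (auto simp: prior_weight_def intro!: divide_nonneg_nonneg sum_nonneg mult_nonneg_nonneg)

text \<open>Grouping the supports by size cancels the binomial coefficients and leaves the normalised geometric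
weights; each size up to \<open>n\<close> does occur, since \<open>n < p\<close>.\<close>
lemma sum_prior_weight:
  assumes \<alpha>: "0 < \<alpha>" and n: "n < CARD('p::finite)"
  shows "(\<Sum>J\<in>UNIV. prior_weight \<alpha> n (J :: 'p set)) = 1"
proof -
  let ?p = "CARD('p)"
  define g where "g k = (if k \<le> n then \<alpha> ^ k / (\<Sum>j = 0..n. \<alpha> ^ j) * inverse (real (?p choose k)) else 0)" for k
  have pos: "0 < (\<Sum>j = 0..n. \<alpha> ^ j)"
    using \<alpha> by (intro sum_pos) auto
  have sub: "card ` (UNIV :: 'p set set) \<subseteq> {0..?p}"
    by (auto simp: card_mono)
  have "(\<Sum>J\<in>UNIV. prior_weight \<alpha> n (J :: 'p set)) = (\<Sum>J\<in>UNIV. g (card (J :: 'p set)))"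
    by (simp add: prior_weight_def g_def)
  also have "\<dots> = (\<Sum>k\<in>{0..?p}. \<Sum>J\<in>{J :: 'p set. card J = k}. g (card J))"
    using sum.group[OF _ _ sub, of "\<lambda>J. g (card J)"] by simp
  also have "\<dots> = (\<Sum>k\<in>{0..?p}. real (?p choose k) * g k)"
    using n_subsets[of "UNIV :: 'p set"] by (intro sum.cong) auto
  also have "\<dots> = (\<Sum>k\<in>{0..n}. \<alpha> ^ k / (\<Sum>j = 0..n. \<alpha> ^ j))"
    using n by (intro sum.mono_neutral_cong_right) (auto simp: g_def)
  also have "\<dots> = 1"
    using pos by (simp add: sum_divide_distrib[symmetric])
  finally show ?thesis .
qed

text \<open>The Stirling-type estimate \<open>k\<^sup>k \<le> e\<^sup>k k!\<close> holds because \<open>k\<^sup>k / k!\<close> is one term of the exponential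
series at \<open>k\<close>.\<close>
lemma binomial_le_exp_power:
  assumes "0 < k"
  shows "real (p choose k) \<le> (exp 1 * real p / real k) ^ k"
proof -
  have "real k ^ k / fact k \<le> (\<Sum>i. real k ^ i / fact i)"
    using exp_converges[of "real k"]
    by (intro sum_le_suminf[where I = "{k}", simplified]) (auto simp: sums_iff divide_inverse mult.commute)
  also have "\<dots> = exp (real k)"
    by (simp add: exp_def divide_inverse mult.commute)
  finally have "real k ^ k \<le> exp 1 ^ k * fact k"
    by (simp add: exp_of_nat_mult[symmetric] field_simps)
  then have "real (p choose k) * real k ^ k \<le> real (p choose k) * (exp 1 ^ k * fact k)"
    by (rule mult_left_mono) simp
  also have "\<dots> = exp 1 ^ k * real ((p choose k) * fact k)"
    by simp
  also have "\<dots> \<le> exp 1 ^ k * real p ^ k"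
    using binomial_fact_pow[of p k] by (intro mult_left_mono) (simp_all only: of_nat_power[symmetric] of_nat_le_iff exp_ge_zero zero_le_power)
  finally show ?thesis
    using assms by (simp add: power_divide power_mult_distrib field_simps)
qed

text \<open>The price of the support \<open>J\<close>. For \<open>J = {}\<close> the first term is \<open>0 * ln 0 = 0\<close>, and only the
normalisation of the geometric weights is paid.\<close>
lemma neg_ln_prior_weight_le:
  fixes J :: "'p::finite set"
  assumes \<alpha>: "0 < \<alpha>" "\<alpha> < 1" and J: "card J \<le> n"
  shows "0 < prior_weight \<alpha> n J"
    and "- ln (prior_weight \<alpha> n J)
      \<le> real (card J) * ln (exp 1 * real CARD('p) / (\<alpha> * real (card J))) + ln (1 / (1 - \<alpha>))"
proof -
  let ?k = "card J" and ?p = "CARD('p)"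
  let ?s = "\<Sum>j = 0..n. \<alpha> ^ j" and ?b = "real (?p choose ?k)"
  have s: "0 < ?s"
    using \<alpha> by (intro sum_pos) auto
  have "?s \<le> 1 / (1 - \<alpha>)"
    using \<alpha> by (simp add: sum_gp0 atLeast0AtMost divide_right_mono)
  then have ln_s: "ln ?s \<le> ln (1 / (1 - \<alpha>))"
    using s \<alpha> by (subst ln_le_cancel_iff) auto
  have "?k \<le> ?p"
    by (simp add: card_mono)
  then have b: "0 < ?b" by simp
  have w: "prior_weight \<alpha> n J = \<alpha> ^ ?k / ?s * inverse ?b"
    using J by (simp add: prior_weight_def)
  show "0 < prior_weight \<alpha> n J"
    unfolding w using \<alpha> s b by simp
  have ln_b: "ln ?b \<le> real ?k * ln (exp 1 * real ?p / real ?k)"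
  proof (cases "?k = 0")
    case False
    then have "ln ?b \<le> ln ((exp 1 * real ?p / real ?k) ^ ?k)"
      using binomial_le_exp_power[of ?k ?p] b by (subst ln_le_cancel_iff) (auto simp: card_gt_0_iff)
    then show ?thesis using False by (simp add: ln_realpow)
  qed simp
  have "- ln (prior_weight \<alpha> n J) = ln ?s + ln ?b - real ?k * ln \<alpha>"
    unfolding w using \<alpha> s b by (simp add: ln_mult ln_div ln_inverse ln_realpow)
  also have "\<dots> \<le> ln (1 / (1 - \<alpha>)) + real ?k * ln (exp 1 * real ?p / real ?k) - real ?k * ln \<alpha>"
    using ln_s ln_b by simp
  also have "\<dots> = real ?k * ln (exp 1 * real ?p / (\<alpha> * real ?k)) + ln (1 / (1 - \<alpha>))"
    using \<alpha> by (cases "?k = 0") (auto simp: ln_mult ln_div algebra_simps card_gt_0_iff)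
  finally show "- ln (prior_weight \<alpha> n J)
      \<le> real ?k * ln (exp 1 * real ?p / (\<alpha> * real ?k)) + ln (1 / (1 - \<alpha>))" .
qed

lemma sets_prior [measurable_cong]: "sets (prior \<alpha> n K) = sets borel"
  unfolding prior_def using sets.sigma_sets_eq[of borel] by (simp add: sets_measure_of)

lemma space_prior [simp]: "space (prior \<alpha> n K) = UNIV"
  using sets_eq_imp_space_eq[OF sets_prior] by simp

context
  fixes \<alpha> K :: real and n :: nat
  assumes \<alpha>: "0 < \<alpha>" and K: "0 < K + 1" and n: "n < CARD('p::finite)"
begin

lemma emeasure_prior_eq_1:
  assumes "A \<in> sets borel" and "\<And>J. emeasure (unif (K + 1) J) A = 1"
  shows "emeasure (prior \<alpha> n K :: (real ^ 'p) measure) A = 1"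
proof -
  have "emeasure (prior \<alpha> n K :: (real ^ 'p) measure) A = (\<Sum>J\<in>UNIV. ennreal (prior_weight \<alpha> n (J :: 'p set)))"
    using assms by (simp add: emeasure_prior)
  also have "\<dots> = ennreal (\<Sum>J\<in>UNIV. prior_weight \<alpha> n (J :: 'p set))"
    using prior_weight_nonneg[OF \<alpha>] by (intro sum_ennreal) auto
  finally show ?thesis
    using sum_prior_weight[OF \<alpha> n] by simp
qed

lemma prob_space_prior: "prob_space (prior \<alpha> n K :: (real ^ 'p) measure)"
proof (rule prob_spaceI)
  show "emeasure (prior \<alpha> n K :: (real ^ 'p) measure) (space (prior \<alpha> n K)) = 1"
  proof (simp, rule emeasure_prior_eq_1)
    fix J :: "'p set"
    interpret prob_space "unif (K + 1) J" using K by (rule prob_space_unif)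
    have "space (unif (K + 1) J) = UNIV"
      using sets_eq_imp_space_eq[OF sets_unif] by simp
    then show "emeasure (unif (K + 1) J) UNIV = 1"
      using emeasure_space_1 by simp
  qed simp
qed

lemma AE_prior_Theta: "AE \<theta> in (prior \<alpha> n K :: (real ^ 'p) measure). \<theta> \<in> Theta (K + 1) UNIV"
proof -
  interpret prob_space "prior \<alpha> n K :: (real ^ 'p) measure" by (rule prob_space_prior)
  have "emeasure (prior \<alpha> n K :: (real ^ 'p) measure) (Theta (K + 1) UNIV) = 1"
    using emeasure_unif_Theta[OF K] by (intro emeasure_prior_eq_1) auto
  then show ?thesis
    by (intro AE_prob_1) (simp add: emeasure_eq_measure)
qed

text \<open>A mixture dominates each of its weighted components. This is how the prior charges the
neighbourhood of a sparse parameter.\<close>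
lemma measure_prior_ge:
  assumes A: "A \<in> sets borel" and u: "emeasure (unif (K + 1) J) A = ennreal u" and "0 \<le> u"
  shows "prior_weight \<alpha> n J * u \<le> measure (prior \<alpha> n K :: (real ^ 'p) measure) A"
proof -
  interpret prob_space "prior \<alpha> n K :: (real ^ 'p) measure" by (rule prob_space_prior)
  have "ennreal (prior_weight \<alpha> n J) * emeasure (unif (K + 1) J) A \<le> emeasure (prior \<alpha> n K :: (real ^ 'p) measure) A"
    unfolding emeasure_prior[OF A]
    by (rule member_le_sum[of J UNIV "\<lambda>J. ennreal (prior_weight \<alpha> n J) * emeasure (unif (K + 1) J) A"]) auto
  then show ?thesis
    using prior_weight_nonneg[OF \<alpha>, of n J] \<open>0 \<le> u\<close>
    by (simp add: u emeasure_eq_measure ennreal_mult[symmetric])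
qed

end

section \<open>Linear predictors and the empirical risk\<close>

lemma lin_pred_diff: "lin_pred \<phi> (a - b) x = lin_pred \<phi> a x - lin_pred \<phi> b x"
  by (simp add: lin_pred_def sum_subtractf algebra_simps)

lemma lin_pred_add: "lin_pred \<phi> (a + b) x = lin_pred \<phi> a x + lin_pred \<phi> b x"
  by (simp add: lin_pred_def sum.distrib algebra_simps)

lemma lin_pred_scaleR: "lin_pred \<phi> (c *\<^sub>R a) x = c * lin_pred \<phi> a x"
  by (simp add: lin_pred_def sum_distrib_left algebra_simps)

lemma abs_lin_pred_le:
  assumes "\<And>j. \<bar>\<phi> j x\<bar> \<le> L"
  shows "\<bar>lin_pred \<phi> \<theta> x\<bar> \<le> L * l1_norm \<theta>"
proof -
  have "\<bar>lin_pred \<phi> \<theta> x\<bar> \<le> (\<Sum>j\<in>UNIV. \<bar>\<theta> $ j * \<phi> j x\<bar>)"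
    unfolding lin_pred_def by (rule sum_abs)
  also have "\<dots> \<le> (\<Sum>j\<in>UNIV. L * \<bar>\<theta> $ j\<bar>)"
    using assms by (intro sum_mono) (simp add: abs_mult mult.commute[of L] mult_left_mono)
  finally show ?thesis by (simp add: l1_norm_def sum_distrib_left)
qed

lemma l1_norm_nonneg: "0 \<le> l1_norm \<theta>"
  unfolding l1_norm_def by (intro sum_nonneg) auto

lemma l1_norm_diff_le: "l1_norm (a - b) \<le> l1_norm a + l1_norm b"
  unfolding l1_norm_def by (simp add: sum.distrib[symmetric] sum_mono)

lemma lin_pred_measurable:
  assumes "\<And>j. \<phi> j \<in> borel_measurable N"
  shows "lin_pred \<phi> \<theta> \<in> borel_measurable N"
  unfolding lin_pred_def using assms by measurable

lemma emp_risk_measurable_pair: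
  fixes \<phi> :: "'p::finite \<Rightarrow> 'x \<Rightarrow> real"
  assumes [measurable]: "\<And>j. \<phi> j \<in> borel_measurable N"
  shows "(\<lambda>(z, \<theta>). emp_risk \<phi> n z \<theta>) \<in> borel_measurable (sample_space N n \<Otimes>\<^sub>M borel)"
proof -
  have [measurable]: "(\<lambda>z. z i) \<in> measurable (sample_space N n) (N \<Otimes>\<^sub>M borel)"
    if "i \<in> {1..n}" for i
    using that unfolding sample_space_def by (rule measurable_component_singleton)
  show ?thesis unfolding emp_risk_def lin_pred_def split_beta'
    by (intro borel_measurable_times borel_measurable_const borel_measurable_sum) measurable
qed

lemma emp_risk_continuous: "continuous_on A (emp_risk \<phi> n z)"
  unfolding emp_risk_def lin_pred_def by (intro continuous_intros)

lemma compact_Theta: "compact (Theta c UNIV :: (real ^ 'p::finite) set)"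
proof -
  have "norm \<theta> \<le> l1_norm \<theta>" for \<theta> :: "real ^ 'p"
    unfolding l1_norm_def by (rule norm_le_l1_cart)
  then have "bounded (Theta c UNIV :: (real ^ 'p) set)"
    unfolding bounded_iff Theta_UNIV by (auto intro: order_trans)
  moreover have "closed (Theta c UNIV :: (real ^ 'p) set)"
    unfolding Theta_UNIV l1_norm_def by (intro closed_Collect_le continuous_intros)
  ultimately show ?thesis by (simp add: compact_eq_bounded_closed)
qed

lemma emp_risk_bounded_on_Theta:
  obtains B where "\<And>\<theta>. \<theta> \<in> Theta c UNIV \<Longrightarrow> \<bar>emp_risk \<phi> n z \<theta>\<bar> \<le> B"
proof -
  have "bounded (emp_risk \<phi> n z ` Theta c UNIV)"
    by (intro compact_imp_bounded compact_continuous_image emp_risk_continuous compact_Theta)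
  then show ?thesis using that by (auto simp: bounded_iff)
qed

text \<open>The numerical part of the Bernstein condition, for moments of order \<open>k = m + 3\<close>. The noise term uses
\<open>2 * 4\<^bsup>k - 2\<^esup> \<le> 8\<^bsup>k - 2\<^esup>\<close>, valid from \<open>k = 3\<close> on, and the bounded term uses \<open>2\<^bsup>k - 1\<^esup> \<le> k! 8\<^bsup>k - 2\<^esup> / 2\<close>;
the factor 8 in the scale \<open>8 * (\<xi> + B) * D\<close> has room for both.\<close>
lemma mixed_moment_arith:
  fixes \<sigma> \<xi> B D :: real
  assumes "0 \<le> \<xi>" "0 \<le> B" "0 \<le> D"
  shows "D ^ Suc m * (2 ^ Suc (Suc m) * (2 ^ (m + 3) * (\<sigma>\<^sup>2 * fact (m + 3) * \<xi> ^ Suc m) + B ^ (m + 3)))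
    \<le> (8 * \<sigma>\<^sup>2 + B\<^sup>2) * fact (m + 3) * (8 * (\<xi> + B) * D) ^ Suc m / 2"
proof -
  let ?k = "fact (m + 3) :: real" and ?s = "(\<xi> + B) ^ Suc m"
  have xi: "\<xi> ^ Suc m \<le> ?s" and Bs: "B ^ Suc m \<le> ?s"
    using assms by (intro power_mono; simp)+
  have k: "6 \<le> ?k"
    using fact_mono[of 3 "m + 3", where ?'a = real] by (simp add: eval_nat_numeral)
  have four: "2 * (4::real) ^ Suc m \<le> 8 ^ Suc m"
  proof -
    have "(2::real) \<le> 2 ^ Suc m" by simp
    then have "2 * (4::real) ^ Suc m \<le> 2 ^ Suc m * 4 ^ Suc m"
      by (rule mult_right_mono) simp
    also have "\<dots> = 8 ^ Suc m" unfolding power_mult_distrib[symmetric] by simp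
    finally show ?thesis .
  qed
  have two: "2 ^ Suc (Suc m) \<le> ?k * 8 ^ Suc m / 2"
  proof -
    have "(2::real) ^ Suc m \<le> 8 ^ Suc m" by (intro power_mono) auto
    then have "2 * (2::real) ^ Suc m \<le> ?k / 2 * 8 ^ Suc m"
      using k by (intro mult_mono) auto
    then show ?thesis by simp
  qed
  have "2 ^ Suc (Suc m) * (2 ^ (m + 3) * (\<sigma>\<^sup>2 * ?k * \<xi> ^ Suc m)) = 8 * 4 ^ Suc m * (\<sigma>\<^sup>2 * ?k) * \<xi> ^ Suc m"
  proof -
    have "(2::real) ^ Suc (Suc m) * 2 ^ (m + 3) = 8 * (2 ^ Suc m * 2 ^ Suc m)"
      by (simp add: power_add)
    also have "\<dots> = 8 * 4 ^ Suc m"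
      unfolding power_mult_distrib[symmetric] by simp
    finally show ?thesis by (simp only: mult.assoc[symmetric])
  qed
  also have "\<dots> \<le> 4 * 8 ^ Suc m * (\<sigma>\<^sup>2 * ?k) * ?s"
  proof -
    have "8 * (4::real) ^ Suc m \<le> 4 * 8 ^ Suc m" using four by linarith
    from mult_mono[OF mult_right_mono[OF this] xi, of "\<sigma>\<^sup>2 * ?k"] show ?thesis
      using assms by simp
  qed
  finally have 1: "2 ^ Suc (Suc m) * (2 ^ (m + 3) * (\<sigma>\<^sup>2 * ?k * \<xi> ^ Suc m)) \<le> 4 * 8 ^ Suc m * (\<sigma>\<^sup>2 * ?k) * ?s" .
  have "2 ^ Suc (Suc m) * B ^ (m + 3) = 2 ^ Suc (Suc m) * (B\<^sup>2 * B ^ Suc m)"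
    by (simp add: power_add eval_nat_numeral)
  also have "\<dots> \<le> ?k * 8 ^ Suc m / 2 * (B\<^sup>2 * ?s)"
    using two Bs assms by (intro mult_mono) auto
  finally have 2: "2 ^ Suc (Suc m) * B ^ (m + 3) \<le> ?k * 8 ^ Suc m / 2 * (B\<^sup>2 * ?s)" .
  have "2 ^ Suc (Suc m) * (2 ^ (m + 3) * (\<sigma>\<^sup>2 * ?k * \<xi> ^ Suc m) + B ^ (m + 3))
      \<le> (8 * \<sigma>\<^sup>2 + B\<^sup>2) * ?k * (8 ^ Suc m * ?s) / 2"
  proof -
    have "(8 * \<sigma>\<^sup>2 + B\<^sup>2) * k * (E * s) / 2 = 4 * E * (\<sigma>\<^sup>2 * k) * s + k * E / 2 * (B\<^sup>2 * s)" for k E s :: real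
      by (simp add: field_simps)
    then show ?thesis
      using add_mono[OF 1 2] by (simp only: distrib_left)
  qed
  then have "D ^ Suc m * (2 ^ Suc (Suc m) * (2 ^ (m + 3) * (\<sigma>\<^sup>2 * ?k * \<xi> ^ Suc m) + B ^ (m + 3)))
      \<le> D ^ Suc m * ((8 * \<sigma>\<^sup>2 + B\<^sup>2) * ?k * (8 ^ Suc m * ?s) / 2)"
    using assms by (intro mult_left_mono) auto
  also have "\<dots> = (8 * \<sigma>\<^sup>2 + B\<^sup>2) * ?k * (8 * (\<xi> + B) * D) ^ Suc m / 2"
    by (simp only: power_mult_distrib) (simp only: mult_ac times_divide_eq_right)
  finally show ?thesis .
qed

section \<open>The Gibbs measure and its mean\<close>

lemma emp_risk_measurable_coeff: "emp_risk \<phi> n z \<in> borel_measurable borel"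
  by (intro borel_measurable_continuous_onI emp_risk_continuous)

context
  fixes \<alpha> K :: real and n :: nat
  assumes \<alpha>: "0 < \<alpha>" and K: "0 < K + 1" and n: "n < CARD('p::finite)"
begin

lemma set_integral_prior_Theta:
  fixes g :: "real ^ 'p \<Rightarrow> real"
  assumes [measurable]: "g \<in> borel_measurable borel"
  shows "(LINT \<theta>:Theta (K + 1) UNIV|prior \<alpha> n K. g \<theta>) = (\<integral>\<theta>. g \<theta> \<partial>prior \<alpha> n K)"
  unfolding set_lebesgue_integral_def
  using AE_prior_Theta[OF \<alpha> K n] by (intro integral_cong_AE) (auto simp: indicator_def)

lemma gibbs_eq:
  fixes \<phi> :: "'p \<Rightarrow> 'x \<Rightarrow> real"
  shows "gibbs \<phi> n \<alpha> K l z = density (prior \<alpha> n K)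
    (\<lambda>t. ennreal (exp (- l * emp_risk \<phi> n z t) / (\<integral>s. exp (- l * emp_risk \<phi> n z s) \<partial>prior \<alpha> n K)))"
proof -
  note [measurable] = emp_risk_measurable_coeff[of \<phi> n z]
  show ?thesis unfolding gibbs_def by (subst set_integral_prior_Theta) auto
qed

lemma AE_emp_risk_bounded:
  fixes \<phi> :: "'p \<Rightarrow> 'x \<Rightarrow> real"
  obtains Br where "AE t in prior \<alpha> n K. \<bar>emp_risk \<phi> n z t\<bar> \<le> Br"
proof -
  obtain Br where "\<And>t. t \<in> Theta (K + 1) UNIV \<Longrightarrow> \<bar>emp_risk \<phi> n z t\<bar> \<le> Br"
    using emp_risk_bounded_on_Theta by blast
  then show ?thesis
    using AE_prior_Theta[OF \<alpha> K n] that by (metis (mono_tags, lifting) eventually_mono)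
qed

lemma prob_space_gibbs:
  fixes \<phi> :: "'p \<Rightarrow> 'x \<Rightarrow> real"
  shows "prob_space (gibbs \<phi> n \<alpha> K l z)"
proof -
  obtain Br where "AE t in prior \<alpha> n K. \<bar>emp_risk \<phi> n z t\<bar> \<le> Br"
    by (rule AE_emp_risk_bounded)
  then show ?thesis
    unfolding gibbs_eq using prob_space_prior[OF \<alpha> K n] emp_risk_measurable_coeff[of \<phi> n z]
    by (intro prob_space_gibbs_density) (auto cong: measurable_cong_sets)
qed

lemma sets_gibbs [measurable_cong]:
  fixes \<phi> :: "'p \<Rightarrow> 'x \<Rightarrow> real"
  shows "sets (gibbs \<phi> n \<alpha> K l z) = sets borel"
  unfolding gibbs_def by (simp add: sets_prior)

lemma AE_gibbs_Theta:
  fixes \<phi> :: "'p \<Rightarrow> 'x \<Rightarrow> real"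
  shows "AE t in gibbs \<phi> n \<alpha> K l z. t \<in> Theta (K + 1) UNIV"
proof -
  note [measurable] = emp_risk_measurable_coeff[of \<phi> n z]
  show ?thesis
    unfolding gibbs_eq using AE_prior_Theta[OF \<alpha> K n] by (subst AE_density) auto
qed

lemma gibbs_est_eq_mean:
  fixes \<phi> :: "'p \<Rightarrow> 'x \<Rightarrow> real"
  shows "gibbs_est \<phi> n \<alpha> K l z = (\<integral>\<theta>. \<theta> \<partial>gibbs \<phi> n \<alpha> K l z)"
  unfolding gibbs_est_def set_lebesgue_integral_def
  using AE_gibbs_Theta[of \<phi> l z] by (intro integral_cong_AE) (auto simp: indicator_def)

text \<open>The estimator is a ratio of two integrals over the parameter that depend measurably on the data.
This makes the event of the oracle inequality measurable.\<close>
lemma gibbs_est_measurable: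
  fixes \<phi> :: "'p \<Rightarrow> 'x \<Rightarrow> real"
  assumes \<phi>: "\<And>j. \<phi> j \<in> borel_measurable N"
  shows "(\<lambda>z. gibbs_est \<phi> n \<alpha> K l z) \<in> borel_measurable (sample_space N n)"
proof -
  interpret m: prob_space "prior \<alpha> n K :: (real ^ 'p) measure"
    by (rule prob_space_prior[OF \<alpha> K n])
  let ?m = "prior \<alpha> n K :: (real ^ 'p) measure"
  let ?Z = "\<lambda>z. \<integral>s. exp (- l * emp_risk \<phi> n z s) \<partial>?m"
  have r[measurable]: "(\<lambda>(z, \<theta>). emp_risk \<phi> n z \<theta>) \<in> borel_measurable (sample_space N n \<Otimes>\<^sub>M ?m)"
    using emp_risk_measurable_pair[OF \<phi>, where n = n]
    by (subst measurable_cong_sets[OF sets_pair_measure_cong[OF refl sets_prior] refl])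
  have "gibbs_est \<phi> n \<alpha> K l z = (\<integral>\<theta>. (exp (- l * emp_risk \<phi> n z \<theta>) / ?Z z) *\<^sub>R \<theta> \<partial>?m)" for z
  proof -
    note [measurable] = emp_risk_measurable_coeff[of \<phi> n z]
    show ?thesis
      unfolding gibbs_est_eq_mean gibbs_eq
      by (rule integral_density) (auto intro!: divide_nonneg_nonneg Bochner_Integration.integral_nonneg)
  qed
  then have eq: "(\<lambda>z. gibbs_est \<phi> n \<alpha> K l z)
      = (\<lambda>z. \<integral>\<theta>. (exp (- l * emp_risk \<phi> n z \<theta>) / ?Z z) *\<^sub>R \<theta> \<partial>?m)" by auto
  have [measurable]: "?Z \<in> borel_measurable (sample_space N n)"
    by (rule m.borel_measurable_lebesgue_integral) measurable
  show ?thesis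
    unfolding eq by (rule m.borel_measurable_lebesgue_integral) measurable
qed

end

section \<open>The regression model and the excess risk\<close>

lemma (in prob_space) indep_set_mono:
  "indep_set A B \<Longrightarrow> A' \<subseteq> A \<Longrightarrow> B' \<subseteq> B \<Longrightarrow> indep_set A' B'"
  unfolding indep_sets2_eq by blast

text \<open>The constants \<open>F\<close> and \<open>L\<close> are arbitrary uniform bounds for \<open>f\<close> and for the dictionary, so that the
suprema are dealt with only once, when the model is instantiated.\<close>
locale sparse_regression = prob_space M for M :: "'w measure" +
  fixes N :: "'x measure" and n :: nat
    and X :: "nat \<Rightarrow> 'w \<Rightarrow> 'x" and Y W :: "nat \<Rightarrow> 'w \<Rightarrow> real"
    and f :: "'x \<Rightarrow> real" and \<phi> :: "'p::finite \<Rightarrow> 'x \<Rightarrow> real"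
    and \<sigma> \<xi> F L K :: real and \<theta>bar :: "real ^ 'p"
  assumes n: "n \<ge> 1"
    and X_meas: "\<And>i. i \<in> {1..n} \<Longrightarrow> X i \<in> measurable M N"
    and W_meas: "\<And>i. i \<in> {1..n} \<Longrightarrow> W i \<in> borel_measurable M"
    and f_meas: "f \<in> borel_measurable N" and f_le: "\<And>x. x \<in> space N \<Longrightarrow> \<bar>f x\<bar> \<le> F"
    and Y_eq: "\<And>i \<omega>. i \<in> {1..n} \<Longrightarrow> \<omega> \<in> space M \<Longrightarrow> Y i \<omega> = f (X i \<omega>) + W i \<omega>"
    and pairs_indep: "indep_vars (\<lambda>_. N \<Otimes>\<^sub>M borel) (\<lambda>i \<omega>. (X i \<omega>, Y i \<omega>)) {1..n}"
    and W_indep_X: "indep_set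
         (sets (vimage_algebra (space M) (\<lambda>\<omega>. \<lambda>i\<in>{1..n}. W i \<omega>) (Pi\<^sub>M {1..n} (\<lambda>_. borel))))
         (sets (vimage_algebra (space M) (\<lambda>\<omega>. \<lambda>i\<in>{1..n}. X i \<omega>) (Pi\<^sub>M {1..n} (\<lambda>_. N))))"
    and \<sigma>: "\<sigma> > 0" and \<xi>: "\<xi> > 0"
    and W_mean: "\<And>i. i \<in> {1..n} \<Longrightarrow> integrable M (W i) \<and> expectation (W i) = 0"
    and W_var: "\<And>i. i \<in> {1..n} \<Longrightarrow>
      integrable M (\<lambda>\<omega>. (W i \<omega>)\<^sup>2) \<and> expectation (\<lambda>\<omega>. (W i \<omega>)\<^sup>2) \<le> \<sigma>\<^sup>2"
    and W_mom: "\<And>i k. i \<in> {1..n} \<Longrightarrow> k \<ge> 3 \<Longrightarrow>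
      integrable M (\<lambda>\<omega>. \<bar>W i \<omega>\<bar> ^ k) \<and>
      expectation (\<lambda>\<omega>. \<bar>W i \<omega>\<bar> ^ k) \<le> \<sigma>\<^sup>2 * fact k * \<xi> ^ (k - 2)"
    and \<phi>_meas: "\<And>j. \<phi> j \<in> borel_measurable N"
    and \<phi>_le: "\<And>j x. x \<in> space N \<Longrightarrow> \<bar>\<phi> j x\<bar> \<le> L"
    and L: "0 \<le> L" and K: "0 \<le> K"
    and \<theta>bar_min: "\<And>\<theta>. int_risk M N \<phi> n X Y \<theta>bar \<le> int_risk M N \<phi> n X Y \<theta>"
    and \<theta>bar_K: "l1_norm \<theta>bar \<le> K"
begin

abbreviation "D \<equiv> L * (2 * K + 1)"
abbreviation "B \<equiv> 2 * F + D"
abbreviation "C1 \<equiv> C1_const \<sigma> \<xi> F L K"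
abbreviation "lam \<equiv> real n / (2 * C1)"
abbreviation "R \<equiv> int_risk M N \<phi> n X Y"
abbreviation "emp \<omega> \<equiv> emp_risk \<phi> n (sample n X Y \<omega>)"

text \<open>The mean square of \<open>f\<^sub>\<theta> - f\<^bsub>\<theta>bar\<^esub>\<close> over the design. The name anticipates that it equals the excess
risk, which holds because \<open>\<theta>bar\<close> is a minimiser.\<close>
definition excess :: "real ^ 'p \<Rightarrow> real" where
  "excess \<theta> = expectation (\<lambda>\<omega>. (1 / real n) * (\<Sum>i = 1..n. (lin_pred \<phi> (\<theta> - \<theta>bar) (X i \<omega>))\<^sup>2))"

lemma Y_meas: "i \<in> {1..n} \<Longrightarrow> Y i \<in> borel_measurable M"
  using measurable_compose[OF X_meas f_meas] W_meas Y_eq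
  by (subst measurable_cong[where g = "\<lambda>\<omega>. f (X i \<omega>) + W i \<omega>"]) auto

lemma X_space: "i \<in> {1..n} \<Longrightarrow> \<omega> \<in> space M \<Longrightarrow> X i \<omega> \<in> space N"
  using X_meas measurable_space by metis

lemma F_nonneg: "0 \<le> F"
proof -
  obtain \<omega> where "\<omega> \<in> space M" using not_empty by auto
  then have "X 1 \<omega> \<in> space N" using X_space n by simp
  then show ?thesis using f_le by (meson abs_ge_zero order_trans)
qed

lemma D_nonneg: "0 \<le> D" and B_nonneg: "0 \<le> B"
  using L K F_nonneg by auto

lemma C1_ge: "8 * \<sigma>\<^sup>2 + B\<^sup>2 \<le> C1" "8 * (\<xi> + B) * D \<le> C1" "D\<^sup>2 \<le> C1" "0 < C1"
proof -
  show *: "8 * \<sigma>\<^sup>2 + B\<^sup>2 \<le> C1" "8 * (\<xi> + B) * D \<le> C1"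
    by (simp_all add: C1_const_def)
  have "D\<^sup>2 \<le> B\<^sup>2" using D_nonneg F_nonneg by (intro power_mono) auto
  with * show "D\<^sup>2 \<le> C1" by (smt (verit) zero_le_power2)
  have "0 < \<sigma>\<^sup>2" using \<sigma> by simp
  with *(1) show "0 < C1" by (smt (verit) zero_le_power2)
qed

lemma design_integrable:
  fixes g :: "'x \<Rightarrow> real"
  assumes "i \<in> {1..n}" and "g \<in> borel_measurable N" and "\<And>x. x \<in> space N \<Longrightarrow> \<bar>g x\<bar> \<le> c"
  shows "integrable M (\<lambda>\<omega>. g (X i \<omega>))"
  using assms X_space measurable_compose[OF X_meas assms(2)]
  by (intro integrable_const_bound[where B = c]) auto

text \<open>Independence of the noise vector from the design vector passes to functions of their \<open>i\<close>-th
entries, which generate smaller \<open>\<sigma>\<close>-algebras.\<close>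
lemma design_noise_indep:
  fixes g :: "'x \<Rightarrow> real" and h :: "real \<Rightarrow> real"
  assumes i: "i \<in> {1..n}" and g: "g \<in> borel_measurable N" and g_le: "\<And>x. x \<in> space N \<Longrightarrow> \<bar>g x\<bar> \<le> c"
    and h: "h \<in> borel_measurable borel" and h_int: "integrable M (\<lambda>\<omega>. h (W i \<omega>))"
  shows "integrable M (\<lambda>\<omega>. g (X i \<omega>) * h (W i \<omega>))"
    and "expectation (\<lambda>\<omega>. g (X i \<omega>) * h (W i \<omega>))
      = expectation (\<lambda>\<omega>. g (X i \<omega>)) * expectation (\<lambda>\<omega>. h (W i \<omega>))"
proof -
  have ind: "indep_var borel (\<lambda>\<omega>. h (W i \<omega>)) borel (\<lambda>\<omega>. g (X i \<omega>))"
  proof -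
    let ?VW = "vimage_algebra (space M) (\<lambda>\<omega>. \<lambda>i\<in>{1..n}. W i \<omega>) (Pi\<^sub>M {1..n} (\<lambda>_. borel))"
    let ?VX = "vimage_algebra (space M) (\<lambda>\<omega>. \<lambda>i\<in>{1..n}. X i \<omega>) (Pi\<^sub>M {1..n} (\<lambda>_. N))"
    have "(\<lambda>\<omega>. (\<lambda>i\<in>{1..n}. W i \<omega>) i) \<in> borel_measurable ?VW"
      using i by (intro measurable_compose[OF measurable_vimage_algebra1 measurable_component_singleton])
        (auto simp: space_PiM)
    then have W': "(\<lambda>\<omega>. h (W i \<omega>)) \<in> borel_measurable ?VW"
      using measurable_compose[OF _ h] i by simp
    have "(\<lambda>\<omega>. (\<lambda>i\<in>{1..n}. X i \<omega>) i) \<in> measurable ?VX N"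
      using i X_space by (intro measurable_compose[OF measurable_vimage_algebra1 measurable_component_singleton])
        (auto simp: space_PiM)
    then have X': "(\<lambda>\<omega>. g (X i \<omega>)) \<in> borel_measurable ?VX"
      using measurable_compose[OF _ g] i by simp
    have sub: "sigma_sets (space M) {u -` A \<inter> space M |A. A \<in> sets borel} \<subseteq> sets V"
      if "u \<in> borel_measurable V" "space V = space M" for u :: "'w \<Rightarrow> real" and V :: "'w measure"
    proof -
      have "{u -` A \<inter> space M |A. A \<in> sets borel} \<subseteq> sets V"
        using measurable_sets[OF that(1)] that(2) by auto
      from sets.sigma_sets_subset[OF this] show ?thesis
        using that(2) by simp
    qed
    show ?thesis
      unfolding indep_var_eq
    proof (intro conjI)
      show "random_variable borel (\<lambda>\<omega>. h (W i \<omega>))" "random_variable borel (\<lambda>\<omega>. g (X i \<omega>))"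
        using measurable_compose[OF W_meas[OF i] h] measurable_compose[OF X_meas[OF i] g] by auto
      show "indep_set (sigma_sets (space M) {(\<lambda>\<omega>. h (W i \<omega>)) -` A \<inter> space M |A. A \<in> sets borel})
          (sigma_sets (space M) {(\<lambda>\<omega>. g (X i \<omega>)) -` A \<inter> space M |A. A \<in> sets borel})"
        by (rule indep_set_mono[OF W_indep_X sub[OF W'] sub[OF X']]) simp_all
    qed
  qed
  note gi = design_integrable[OF i g g_le]
  show "integrable M (\<lambda>\<omega>. g (X i \<omega>) * h (W i \<omega>))"
    using indep_var_integrable[OF ind h_int gi] by (simp add: mult.commute)
  show "expectation (\<lambda>\<omega>. g (X i \<omega>) * h (W i \<omega>))
      = expectation (\<lambda>\<omega>. g (X i \<omega>)) * expectation (\<lambda>\<omega>. h (W i \<omega>))"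
    using indep_var_lebesgue_integral[OF ind h_int gi] by (simp add: mult.commute)
qed

lemma lin_pred_meas: "lin_pred \<phi> \<theta> \<in> borel_measurable N"
  by (rule lin_pred_measurable[OF \<phi>_meas])

lemma lin_pred_le: "x \<in> space N \<Longrightarrow> \<bar>lin_pred \<phi> \<theta> x\<bar> \<le> L * l1_norm \<theta>"
  using abs_lin_pred_le[of \<phi> x L \<theta>] \<phi>_le by auto

lemma lin_pred_sq_integrable:
  "i \<in> {1..n} \<Longrightarrow> integrable M (\<lambda>\<omega>. lin_pred \<phi> a (X i \<omega>) * lin_pred \<phi> b (X i \<omega>))"
  using lin_pred_meas lin_pred_le
  by (intro design_integrable[where c = "(L * l1_norm a) * (L * l1_norm b)"])
     (auto simp: abs_mult intro!: mult_mono mult_nonneg_nonneg L l1_norm_nonneg)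

lemma int_risk_eq: "R \<theta> = expectation (\<lambda>\<omega>. (1 / real n) * (\<Sum>i = 1..n. (Y i \<omega> - lin_pred \<phi> \<theta> (X i \<omega>))\<^sup>2))"
  by (rule int_risk_copy[OF \<phi>_meas X_meas Y_meas refl])

lemma residual_integrable:
  assumes i: "i \<in> {1..n}"
  shows "integrable M (\<lambda>\<omega>. (Y i \<omega> - lin_pred \<phi> a (X i \<omega>)) * lin_pred \<phi> b (X i \<omega>))" (is ?A)
    and "integrable M (\<lambda>\<omega>. (Y i \<omega> - lin_pred \<phi> a (X i \<omega>))\<^sup>2)" (is ?B)
proof -
  let ?g = "\<lambda>x. f x - lin_pred \<phi> a x"
  have g: "?g \<in> borel_measurable N" using f_meas lin_pred_meas by auto
  have g_le: "\<bar>?g x\<bar> \<le> F + L * l1_norm a" if "x \<in> space N" for x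
    using f_le[OF that] lin_pred_le[OF that, of a] by auto
  have gb: "(\<lambda>x. ?g x * lin_pred \<phi> b x) \<in> borel_measurable N" using g lin_pred_meas by auto
  have gb_le: "\<bar>?g x * lin_pred \<phi> b x\<bar> \<le> (F + L * l1_norm a) * (L * l1_norm b)" if "x \<in> space N" for x
    unfolding abs_mult using g_le[OF that] lin_pred_le[OF that, of b] by (intro mult_mono) auto
  have gg_le: "\<bar>?g x * ?g x\<bar> \<le> (F + L * l1_norm a) * (F + L * l1_norm a)" if "x \<in> space N" for x
    unfolding abs_mult using g_le[OF that] by (intro mult_mono) auto
  note W_int = W_mean[OF i, THEN conjunct1]
  have "integrable M (\<lambda>\<omega>. ?g (X i \<omega>) * lin_pred \<phi> b (X i \<omega>) + lin_pred \<phi> b (X i \<omega>) * W i \<omega>)"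
    using design_integrable[OF i gb gb_le]
      design_noise_indep(1)[OF i lin_pred_meas lin_pred_le measurable_ident_sets[OF refl] W_int]
    by (intro Bochner_Integration.integrable_add) auto
  then show ?A
    by (rule Bochner_Integration.integrable_cong[THEN iffD1, rotated -1])
       (auto simp: Y_eq[OF i] algebra_simps)
  have "integrable M (\<lambda>\<omega>. ?g (X i \<omega>) * ?g (X i \<omega>) + 2 * (?g (X i \<omega>) * W i \<omega>) + (W i \<omega>)\<^sup>2)"
    using design_integrable[OF i borel_measurable_times[OF g g] gg_le]
      design_noise_indep(1)[OF i g g_le measurable_ident_sets[OF refl] W_int] W_var[OF i]
    by (intro Bochner_Integration.integrable_add integrable_mult_right) auto
  then show ?B
    by (rule Bochner_Integration.integrable_cong[THEN iffD1, rotated -1])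
       (auto simp: Y_eq[OF i] algebra_simps power2_eq_square)
qed

text \<open>Along each line \<open>\<theta>bar + t h\<close> the risk is a parabola in \<open>t\<close>. Minimality over all of \<open>\<real>\<^sup>p\<close>, rather
than over an \<open>\<ell>\<^sub>1\<close> ball, allows both signs of \<open>t\<close> and forces the linear coefficient to vanish.\<close>
lemma int_risk_eq_excess: "R \<theta> = R \<theta>bar + excess \<theta>"
proof -
  define cr where "cr h = expectation (\<lambda>\<omega>. (1 / real n) *
    (\<Sum>i = 1..n. (Y i \<omega> - lin_pred \<phi> \<theta>bar (X i \<omega>)) * lin_pred \<phi> h (X i \<omega>)))" for h
  define qd where "qd h = expectation (\<lambda>\<omega>. (1 / real n) * (\<Sum>i = 1..n. lin_pred \<phi> h (X i \<omega>) * lin_pred \<phi> h (X i \<omega>)))" for h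
  have expand: "R (\<theta>bar + h) = R \<theta>bar - 2 * cr h + qd h" for h
  proof -
    have "R (\<theta>bar + h) = expectation (\<lambda>\<omega>.
        (1 / real n) * (\<Sum>i = 1..n. (Y i \<omega> - lin_pred \<phi> \<theta>bar (X i \<omega>))\<^sup>2)
        - 2 * ((1 / real n) * (\<Sum>i = 1..n. (Y i \<omega> - lin_pred \<phi> \<theta>bar (X i \<omega>)) * lin_pred \<phi> h (X i \<omega>)))
        + (1 / real n) * (\<Sum>i = 1..n. lin_pred \<phi> h (X i \<omega>) * lin_pred \<phi> h (X i \<omega>)))"
      unfolding int_risk_eq lin_pred_add
      by (intro Bochner_Integration.integral_cong refl)
         (simp add: sum_distrib_left sum.distrib[symmetric] sum_subtractf[symmetric] power2_eq_square algebra_simps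
           del: sum.distrib sum_subtractf cong: sum.cong)
    also have "\<dots> = R \<theta>bar - 2 * cr h + qd h"
    proof -
      have i1: "integrable M (\<lambda>\<omega>. (1 / real n) * (\<Sum>i = 1..n. (Y i \<omega> - lin_pred \<phi> \<theta>bar (X i \<omega>))\<^sup>2))"
        by (intro integrable_mult_right Bochner_Integration.integrable_sum residual_integrable)
      have i2: "integrable M (\<lambda>\<omega>. 2 * ((1 / real n) *
          (\<Sum>i = 1..n. (Y i \<omega> - lin_pred \<phi> \<theta>bar (X i \<omega>)) * lin_pred \<phi> h (X i \<omega>))))"
        by (intro integrable_mult_right Bochner_Integration.integrable_sum residual_integrable)
      have i3: "integrable M (\<lambda>\<omega>. (1 / real n) * (\<Sum>i = 1..n. lin_pred \<phi> h (X i \<omega>) * lin_pred \<phi> h (X i \<omega>)))"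
        by (intro integrable_mult_right Bochner_Integration.integrable_sum lin_pred_sq_integrable)
      show ?thesis
        unfolding int_risk_eq cr_def qd_def
        unfolding Bochner_Integration.integral_add[OF Bochner_Integration.integrable_diff[OF i1 i2] i3]
          Bochner_Integration.integral_diff[OF i1 i2] integral_mult_right_zero ..
    qed
    finally show ?thesis .
  qed
  have scale: "cr (t *\<^sub>R h) = t * cr h" "qd (t *\<^sub>R h) = t\<^sup>2 * qd h" for t h
    unfolding cr_def qd_def lin_pred_scaleR
    by (simp_all add: integral_mult_right_zero[symmetric] sum_distrib_left algebra_simps power2_eq_square
        del: integral_mult_right_zero)
  have cr0: "cr h = 0" for h
  proof (rule ccontr)
    assume "cr h \<noteq> 0"
    have ge: "0 \<le> - 2 * (t * cr h) + t\<^sup>2 * qd h" for t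
      using \<theta>bar_min[of "\<theta>bar + t *\<^sub>R h"] by (simp add: expand scale)
    have "0 \<le> qd h" 
      unfolding qd_def by (intro Bochner_Integration.integral_nonneg mult_nonneg_nonneg[of "1 / _"] sum_nonneg) auto
    \<comment> \<open>Adding 1 keeps the near-optimal step \<open>cr h / qd h\<close> meaningful for \<open>qd h = 0\<close>.\<close>
    let ?t = "cr h / (qd h + 1)"
    have "?t\<^sup>2 * qd h \<le> ?t\<^sup>2 * (qd h + 1)" by (intro mult_left_mono) auto
    also have "\<dots> = ?t * cr h" using \<open>0 \<le> qd h\<close> by (simp add: power2_eq_square)
    finally have "?t * cr h \<le> 0" using ge[of ?t] by simp
    moreover have "?t * cr h = (cr h)\<^sup>2 / (qd h + 1)" by (simp add: power2_eq_square)
    ultimately show False using \<open>0 \<le> qd h\<close> \<open>cr h \<noteq> 0\<close> by (simp add: divide_le_0_iff)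
  qed
  show ?thesis
    using expand[of "\<theta> - \<theta>bar"] cr0 by (simp add: excess_def qd_def power2_eq_square)
qed

section \<open>Exponential moments of the loss differences\<close>

text \<open>Loss at \<open>\<theta>bar\<close> minus loss at \<open>\<theta>\<close>, for the \<open>i\<close>-th observation; its sum is the difference of
empirical risks, up to the factor \<open>n\<close>.\<close>
definition gap :: "real ^ 'p \<Rightarrow> nat \<Rightarrow> 'w \<Rightarrow> real" where
  "gap \<theta> i \<omega> = (Y i \<omega> - lin_pred \<phi> \<theta>bar (X i \<omega>))\<^sup>2 - (Y i \<omega> - lin_pred \<phi> \<theta> (X i \<omega>))\<^sup>2"

definition coord_excess :: "real ^ 'p \<Rightarrow> nat \<Rightarrow> real" where
  "coord_excess \<theta> i = expectation (\<lambda>\<omega>. (lin_pred \<phi> (\<theta> - \<theta>bar) (X i \<omega>))\<^sup>2)"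

lemma coord_excess_nonneg: "0 \<le> coord_excess \<theta> i"
  unfolding coord_excess_def by (rule Bochner_Integration.integral_nonneg) simp

lemma sum_coord_excess: "(\<Sum>i = 1..n. coord_excess \<theta> i) = real n * excess \<theta>"
  unfolding coord_excess_def excess_def power2_eq_square
  using lin_pred_sq_integrable n by (subst integral_mult_right_zero) simp

lemma sum_gap: "(\<Sum>i = 1..n. gap \<theta> i \<omega>) = real n * (emp \<omega> \<theta>bar - emp \<omega> \<theta>)"
  using n by (simp add: gap_def emp_risk_def sample_def sum_subtractf algebra_simps)

lemma gap_meas: "i \<in> {1..n} \<Longrightarrow> gap \<theta> i \<in> borel_measurable M"
  unfolding gap_def
  using Y_meas measurable_compose[OF X_meas lin_pred_meas] by (intro borel_measurable_diff borel_measurable_power) auto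

lemma gap_integrable: "i \<in> {1..n} \<Longrightarrow> integrable M (gap \<theta> i)"
  unfolding gap_def using residual_integrable(2) by (intro Bochner_Integration.integrable_diff)

lemma sum_expectation_gap: "(\<Sum>i = 1..n. expectation (gap \<theta> i)) = - real n * excess \<theta>"
proof -
  have "(\<Sum>i = 1..n. expectation (gap \<theta> i)) = expectation (\<lambda>\<omega>. \<Sum>i = 1..n. gap \<theta> i \<omega>)"
    using gap_integrable by (intro Bochner_Integration.integral_sum[symmetric]) auto
  also have "\<dots> = real n * expectation (\<lambda>\<omega>. emp \<omega> \<theta>bar - emp \<omega> \<theta>)"
    unfolding sum_gap by simp
  also have "expectation (\<lambda>\<omega>. emp \<omega> \<theta>bar - emp \<omega> \<theta>) = R \<theta>bar - R \<theta>"
  proof -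
    have eq: "emp \<omega> a = (1 / real n) * (\<Sum>i = 1..n. (Y i \<omega> - lin_pred \<phi> a (X i \<omega>))\<^sup>2)" for \<omega> a
      by (simp add: emp_risk_def sample_def)
    have int: "integrable M (\<lambda>\<omega>. (1 / real n) * (\<Sum>i = 1..n. (Y i \<omega> - lin_pred \<phi> a (X i \<omega>))\<^sup>2))" for a
      by (intro integrable_mult_right Bochner_Integration.integrable_sum residual_integrable)
    show ?thesis
      unfolding int_risk_eq eq by (rule Bochner_Integration.integral_diff[OF int int])
  qed
  also have "\<dots> = - excess \<theta>"
    using int_risk_eq_excess[of \<theta>] by linarith
  finally show ?thesis by simp
qed

context
  fixes \<theta> :: "real ^ 'p" and i :: nat
  assumes \<theta>: "\<theta> \<in> Theta (K + 1) UNIV" and i: "i \<in> {1..n}"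
begin

abbreviation (input) "d x \<equiv> lin_pred \<phi> (\<theta> - \<theta>bar) x"
abbreviation (input) "b x \<equiv> 2 * f x - lin_pred \<phi> \<theta>bar x - lin_pred \<phi> \<theta> x"

lemma gap_eq: "\<omega> \<in> space M \<Longrightarrow> gap \<theta> i \<omega> = d (X i \<omega>) * (2 * W i \<omega> + b (X i \<omega>))"
  unfolding gap_def Y_eq[OF i] lin_pred_diff by (simp add: power2_eq_square algebra_simps)

lemma d_le:
  assumes "x \<in> space N" shows "\<bar>d x\<bar> \<le> D"
proof -
  have "l1_norm (\<theta> - \<theta>bar) \<le> 2 * K + 1"
    using l1_norm_diff_le[of \<theta> \<theta>bar] \<theta> \<theta>bar_K by (simp add: Theta_UNIV)
  then have "L * l1_norm (\<theta> - \<theta>bar) \<le> D"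
    using L by (rule mult_left_mono)
  then show ?thesis using lin_pred_le[OF assms, of "\<theta> - \<theta>bar"] by simp
qed

lemma b_le:
  assumes "x \<in> space N" shows "\<bar>b x\<bar> \<le> B"
proof -
  have "L * l1_norm \<theta>bar \<le> L * K" "L * l1_norm \<theta> \<le> L * (K + 1)"
    using L \<theta> \<theta>bar_K by (auto simp: Theta_UNIV intro: mult_left_mono)
  then have "\<bar>lin_pred \<phi> \<theta>bar x\<bar> \<le> L * K" "\<bar>lin_pred \<phi> \<theta> x\<bar> \<le> L * (K + 1)"
    using lin_pred_le[OF assms] order_trans by blast+
  moreover have "L * K + L * (K + 1) = D" by (simp add: algebra_simps)
  ultimately show ?thesis using f_le[OF assms] by linarith
qed

lemma d_meas: "d \<in> borel_measurable N" and b_meas: "b \<in> borel_measurable N"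
  using f_meas lin_pred_meas by auto

lemma d_sq_le: "x \<in> space N \<Longrightarrow> (d x)\<^sup>2 \<le> D\<^sup>2" and b_sq_le: "x \<in> space N \<Longrightarrow> (b x)\<^sup>2 \<le> B\<^sup>2"
  using power_mono[OF d_le abs_ge_zero, of x 2] power_mono[OF b_le abs_ge_zero, of x 2] by (simp_all only: power2_abs)

text \<open>The gap is \<open>d * (2 * W + b)\<close> with \<open>d\<close> and \<open>b\<close> bounded functions of the design point. The cross term
\<open>4 d\<^sup>2 b W\<close> has mean zero, since the noise is centred and independent of the design, and the
remaining terms carry the factor \<open>d\<^sup>2\<close>, whose mean is the contribution to the excess risk.\<close>
lemma gap_second_moment:
  shows "integrable M (\<lambda>\<omega>. (gap \<theta> i \<omega>)\<^sup>2)"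
    and "expectation (\<lambda>\<omega>. (gap \<theta> i \<omega>)\<^sup>2) \<le> (8 * \<sigma>\<^sup>2 + B\<^sup>2) * coord_excess \<theta> i"
proof -
  have d2: "(\<lambda>x. (d x)\<^sup>2) \<in> borel_measurable N" "(\<lambda>x. (d x)\<^sup>2 * b x) \<in> borel_measurable N"
      "(\<lambda>x. (d x)\<^sup>2 * (b x)\<^sup>2) \<in> borel_measurable N"
    using d_meas b_meas by auto
  have d2_le: "\<bar>(d x)\<^sup>2\<bar> \<le> D\<^sup>2" and d2b_le: "\<bar>(d x)\<^sup>2 * b x\<bar> \<le> D\<^sup>2 * B"
      and d2b2_le: "\<bar>(d x)\<^sup>2 * (b x)\<^sup>2\<bar> \<le> D\<^sup>2 * B\<^sup>2" if "x \<in> space N" for x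
    using d_sq_le[OF that] b_le[OF that] b_sq_le[OF that] by (auto simp: abs_mult intro!: mult_mono)
  note W1 = W_mean[OF i] and W2 = W_var[OF i]
  note sq = design_noise_indep[OF i d2(1) d2_le borel_measurable_power[OF measurable_ident_sets[OF refl]] W2[THEN conjunct1]]
  note cross = design_noise_indep[OF i d2(2) d2b_le measurable_ident_sets[OF refl] W1[THEN conjunct1]]
  note base = design_integrable[OF i d2(3) d2b2_le]
  let ?e = "\<lambda>\<omega>. 4 * ((d (X i \<omega>))\<^sup>2 * (W i \<omega>)\<^sup>2) + 4 * ((d (X i \<omega>))\<^sup>2 * b (X i \<omega>) * W i \<omega>)
    + (d (X i \<omega>))\<^sup>2 * (b (X i \<omega>))\<^sup>2"
  have eq: "(gap \<theta> i \<omega>)\<^sup>2 = ?e \<omega>" if "\<omega> \<in> space M" for \<omega>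
    unfolding gap_eq[OF that] by (simp add: power2_eq_square algebra_simps)
  have "integrable M ?e"
    using sq(1) cross(1) base by (intro Bochner_Integration.integrable_add integrable_mult_right)
  then show "integrable M (\<lambda>\<omega>. (gap \<theta> i \<omega>)\<^sup>2)"
    using Bochner_Integration.integrable_cong[of M M "\<lambda>\<omega>. (gap \<theta> i \<omega>)\<^sup>2" ?e, OF refl eq] by blast
  have "expectation (\<lambda>\<omega>. (gap \<theta> i \<omega>)\<^sup>2) = expectation ?e"
    using eq by (intro Bochner_Integration.integral_cong) auto
  also have "\<dots> = 4 * (coord_excess \<theta> i * expectation (\<lambda>\<omega>. (W i \<omega>)\<^sup>2))
      + expectation (\<lambda>\<omega>. (d (X i \<omega>))\<^sup>2 * (b (X i \<omega>))\<^sup>2)"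
    using sq cross base W1 by (simp add: coord_excess_def)
  also have "expectation (\<lambda>\<omega>. (d (X i \<omega>))\<^sup>2 * (b (X i \<omega>))\<^sup>2) \<le> expectation (\<lambda>\<omega>. (d (X i \<omega>))\<^sup>2 * B\<^sup>2)"
  proof (rule integral_mono)
    show "integrable M (\<lambda>\<omega>. (d (X i \<omega>))\<^sup>2 * (b (X i \<omega>))\<^sup>2)"
      using base by simp
    show "integrable M (\<lambda>\<omega>. (d (X i \<omega>))\<^sup>2 * B\<^sup>2)"
      using design_integrable[OF i d2(1) d2_le] by (intro integrable_mult_left) simp
    show "(d (X i \<omega>))\<^sup>2 * (b (X i \<omega>))\<^sup>2 \<le> (d (X i \<omega>))\<^sup>2 * B\<^sup>2" if "\<omega> \<in> space M" for \<omega>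
      using mult_left_mono[OF b_sq_le[OF X_space[OF i that]] zero_le_power2] .
  qed
  also have "4 * (coord_excess \<theta> i * expectation (\<lambda>\<omega>. (W i \<omega>)\<^sup>2)) \<le> 8 * (coord_excess \<theta> i * \<sigma>\<^sup>2)"
    using mult_left_mono[OF W2[THEN conjunct2] coord_excess_nonneg[of \<theta> i]]
      mult_nonneg_nonneg[OF coord_excess_nonneg[of \<theta> i] zero_le_power2[of \<sigma>]] by linarith
  finally show "expectation (\<lambda>\<omega>. (gap \<theta> i \<omega>)\<^sup>2) \<le> (8 * \<sigma>\<^sup>2 + B\<^sup>2) * coord_excess \<theta> i"
    by (simp add: coord_excess_def algebra_simps)
qed

text \<open>Of the \<open>m + 3\<close> factors \<open>d\<close>, two are kept to reproduce the excess risk and the others are bounded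
by \<open>D\<close>.\<close>
lemma gap_higher_moment:
  shows "integrable M (\<lambda>\<omega>. \<bar>gap \<theta> i \<omega>\<bar> ^ (m + 3))"
    and "expectation (\<lambda>\<omega>. \<bar>gap \<theta> i \<omega>\<bar> ^ (m + 3))
      \<le> (8 * \<sigma>\<^sup>2 + B\<^sup>2) * coord_excess \<theta> i * fact (m + 3) * (8 * (\<xi> + B) * D) ^ Suc m / 2"
proof -
  let ?k = "m + 3"
  define g where "g \<omega> = D ^ Suc m * (2 ^ Suc (Suc m) *
    (2 ^ ?k * ((d (X i \<omega>))\<^sup>2 * \<bar>W i \<omega>\<bar> ^ ?k) + B ^ ?k * (d (X i \<omega>))\<^sup>2))" for \<omega>
  have d2: "(\<lambda>x. (d x)\<^sup>2) \<in> borel_measurable N"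
    using d_meas by auto
  have d2_le: "\<bar>(d x)\<^sup>2\<bar> \<le> D\<^sup>2" if "x \<in> space N" for x
    using d_sq_le[OF that] by simp
  note Wk = W_mom[OF i, of ?k]
  have h: "(\<lambda>w::real. \<bar>w\<bar> ^ ?k) \<in> borel_measurable borel"
    by (intro borel_measurable_power borel_measurable_abs measurable_ident_sets[OF refl])
  note dW = design_noise_indep[OF i d2 d2_le h]
  have Wk': "integrable M (\<lambda>\<omega>. \<bar>W i \<omega>\<bar> ^ ?k)" using Wk by simp
  have g_int: "integrable M g"
    unfolding g_def using dW(1)[OF _ Wk'] design_integrable[OF i d2 d2_le]
    by (intro Bochner_Integration.integrable_add integrable_mult_right) auto
  have le: "\<bar>gap \<theta> i \<omega>\<bar> ^ ?k \<le> g \<omega>" if \<omega>: "\<omega> \<in> space M" for \<omega>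
  proof -
    let ?d = "d (X i \<omega>)" and ?b = "b (X i \<omega>)"
    have x: "X i \<omega> \<in> space N" using X_space[OF i \<omega>] .
    have "\<bar>2 * W i \<omega> + ?b\<bar> ^ ?k \<le> (2 * \<bar>W i \<omega>\<bar> + B) ^ ?k"
      using b_le[OF x] by (intro power_mono) auto
    also have "\<dots> \<le> 2 ^ Suc (Suc m) * ((2 * \<bar>W i \<omega>\<bar>) ^ ?k + B ^ ?k)"
      using power_add_le_two_power[of "2 * \<bar>W i \<omega>\<bar>" B "Suc (Suc m)"] B_nonneg
      by (simp only: eval_nat_numeral add_Suc_right add_0_right) simp
    finally have A: "\<bar>2 * W i \<omega> + ?b\<bar> ^ ?k \<le> 2 ^ Suc (Suc m) * ((2 * \<bar>W i \<omega>\<bar>) ^ ?k + B ^ ?k)" .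
    have "\<bar>?d\<bar> ^ ?k = \<bar>?d\<bar> ^ Suc m * ?d\<^sup>2"
    proof -
      have "\<bar>?d\<bar> ^ ?k = \<bar>?d\<bar> ^ Suc m * \<bar>?d\<bar> ^ 2"
        unfolding power_add[symmetric] by (simp only: add_Suc add_Suc_right eval_nat_numeral add_0_right)
      then show ?thesis by simp
    qed
    also have "\<dots> \<le> D ^ Suc m * ?d\<^sup>2"
      using d_le[OF x] by (intro mult_right_mono power_mono) auto
    finally have "\<bar>?d\<bar> ^ ?k \<le> D ^ Suc m * ?d\<^sup>2" .
    then have "\<bar>?d\<bar> ^ ?k * \<bar>2 * W i \<omega> + ?b\<bar> ^ ?k
        \<le> D ^ Suc m * ?d\<^sup>2 * (2 ^ Suc (Suc m) * ((2 * \<bar>W i \<omega>\<bar>) ^ ?k + B ^ ?k))"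
      using A D_nonneg by (intro mult_mono) auto
    also have "\<dots> = g \<omega>"
      unfolding g_def power_mult_distrib by (simp only: algebra_simps)
    finally show ?thesis
      unfolding gap_eq[OF \<omega>] abs_mult power_mult_distrib .
  qed
  show int: "integrable M (\<lambda>\<omega>. \<bar>gap \<theta> i \<omega>\<bar> ^ ?k)"
    using gap_meas[OF i] le
    by (intro Bochner_Integration.integrable_bound[OF g_int]) (auto intro: order_trans[OF _ abs_ge_self])
  have "expectation (\<lambda>\<omega>. \<bar>gap \<theta> i \<omega>\<bar> ^ ?k) \<le> expectation g"
    using int g_int le by (rule integral_mono)
  also have "\<dots> = D ^ Suc m * (2 ^ Suc (Suc m) *
      (2 ^ ?k * (coord_excess \<theta> i * expectation (\<lambda>\<omega>. \<bar>W i \<omega>\<bar> ^ ?k)) + B ^ ?k * coord_excess \<theta> i))"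
    unfolding g_def coord_excess_def
    using dW[OF _ Wk'] design_integrable[OF i d2 d2_le]
    by simp
  also have "\<dots> \<le> D ^ Suc m * (2 ^ Suc (Suc m) *
      (2 ^ ?k * (coord_excess \<theta> i * (\<sigma>\<^sup>2 * fact ?k * \<xi> ^ Suc m)) + B ^ ?k * coord_excess \<theta> i))"
    using Wk D_nonneg coord_excess_nonneg[of \<theta> i]
    by (intro mult_left_mono add_mono order_refl zero_le_power) (auto simp del: fact_Suc)
  also have "\<dots> = coord_excess \<theta> i * (D ^ Suc m * (2 ^ Suc (Suc m) *
      (2 ^ ?k * (\<sigma>\<^sup>2 * fact ?k * \<xi> ^ Suc m) + B ^ ?k)))"
    by (simp only: algebra_simps)
  also have "\<dots> \<le> coord_excess \<theta> i * ((8 * \<sigma>\<^sup>2 + B\<^sup>2) * fact ?k * (8 * (\<xi> + B) * D) ^ Suc m / 2)"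
    using mixed_moment_arith[OF _ B_nonneg D_nonneg, of \<xi> m \<sigma>] \<xi> coord_excess_nonneg[of \<theta> i]
    by (intro mult_left_mono) auto
  finally show "expectation (\<lambda>\<omega>. \<bar>gap \<theta> i \<omega>\<bar> ^ ?k)
      \<le> (8 * \<sigma>\<^sup>2 + B\<^sup>2) * coord_excess \<theta> i * fact ?k * (8 * (\<xi> + B) * D) ^ Suc m / 2"
    by (simp only: mult_ac times_divide_eq_right)
qed

text \<open>This is what fixes the temperature. At \<open>z = 1 / (2 * C1)\<close> the denominator in Bernstein's bound is at
least 1 and the quadratic term is at most half of \<open>z\<close> times the excess, so that a definite fraction
of the linear term survives.\<close>
lemma gap_exp_moment:
  assumes s: "\<bar>s\<bar> = 1"
  shows "(\<integral>\<^sup>+\<omega>. ennreal (exp (1 / (2 * C1) * (s * gap \<theta> i \<omega>))) \<partial>M)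
    \<le> ennreal (exp (1 / (2 * C1) * (s * expectation (gap \<theta> i) + coord_excess \<theta> i / 2)))"
proof -
  let ?z = "1 / (2 * C1)" and ?w = "8 * (\<xi> + B) * D" and ?v = "(8 * \<sigma>\<^sup>2 + B\<^sup>2) * coord_excess \<theta> i"
  have z: "0 < ?z" using C1_ge by simp
  have wz: "?w * ?z \<le> 1 / 2"
    using C1_ge by (simp add: field_simps)
  have v: "0 \<le> ?v"
    using coord_excess_nonneg by (intro mult_nonneg_nonneg add_nonneg_nonneg) auto
  have w: "0 \<le> ?w"
    using \<xi> B_nonneg D_nonneg by (intro mult_nonneg_nonneg[OF _ D_nonneg]) auto
  have "(\<integral>\<^sup>+\<omega>. ennreal (exp (?z * (s * gap \<theta> i \<omega>))) \<partial>M)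
      \<le> ennreal (exp (?z * expectation (\<lambda>\<omega>. s * gap \<theta> i \<omega>) + ?v * ?z\<^sup>2 / (2 * (1 - ?w * ?z))))"
  proof (rule bernstein_exp_moment)
    show "(\<lambda>\<omega>. s * gap \<theta> i \<omega>) \<in> borel_measurable M"
      using gap_meas[OF i] by auto
    show "?w * ?z < 1" using wz by linarith
    fix k :: nat assume k: "2 \<le> k"
    have abs: "\<bar>s * gap \<theta> i \<omega>\<bar> = \<bar>gap \<theta> i \<omega>\<bar>" for \<omega>
      using s by (simp add: abs_mult)
    show "integrable M (\<lambda>\<omega>. \<bar>s * gap \<theta> i \<omega>\<bar> ^ k) \<and>
        expectation (\<lambda>\<omega>. \<bar>s * gap \<theta> i \<omega>\<bar> ^ k) \<le> ?v * fact k * ?w ^ (k - 2) / 2"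
    proof (cases "k = 2")
      case True
      then show ?thesis
        unfolding abs using gap_second_moment by (simp add: fact_2)
    next
      case False
      with k obtain m where m: "k = m + 3"
        by (metis add.commute le_Suc_ex le_neq_implies_less Suc_leI eval_nat_numeral(3) eval_nat_numeral(2))
      have m2: "k - 2 = Suc m" using m by simp
      show ?thesis
        unfolding abs m2 unfolding m using gap_higher_moment[of m] by blast
    qed
  qed (use v w z in auto)
  also have "?v * ?z\<^sup>2 / (2 * (1 - ?w * ?z)) \<le> ?z * (coord_excess \<theta> i / 2)"
  proof -
    have "?v * ?z\<^sup>2 / (2 * (1 - ?w * ?z)) \<le> ?v * ?z\<^sup>2 / 1"
      using wz v by (intro divide_left_mono) auto
    also have "\<dots> \<le> C1 * coord_excess \<theta> i * ?z\<^sup>2"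
      using C1_ge(1) coord_excess_nonneg[of \<theta> i] by (simp add: mult_right_mono)
    also have "\<dots> = ?z * (coord_excess \<theta> i / 2)"
      using C1_ge(4) by (simp add: power2_eq_square)
    finally show ?thesis .
  qed
  finally show ?thesis
    by (simp add: distrib_left)
qed

end

lemma sum_gap_exp_moment:
  assumes \<theta>: "\<theta> \<in> Theta (K + 1) UNIV" and s: "\<bar>s\<bar> = 1"
  shows "(\<integral>\<^sup>+\<omega>. ennreal (exp (lam * (s * (emp \<omega> \<theta>bar - emp \<omega> \<theta>)))) \<partial>M)
    \<le> ennreal (exp (lam * (excess \<theta> / 2 - s * excess \<theta>)))"
proof -
  let ?z = "1 / (2 * C1)"
  let ?E = "\<lambda>i \<omega>. ennreal (exp (?z * (s * gap \<theta> i \<omega>)))"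
  have [measurable]: "lin_pred \<phi> a \<in> borel_measurable N" for a by (rule lin_pred_meas)
  have indep: "indep_vars (\<lambda>_. borel) ?E {1..n}"
    using indep_vars_compose2[OF pairs_indep, of
        "\<lambda>_ (x, y). ennreal (exp (?z * (s * ((y - lin_pred \<phi> \<theta>bar x)\<^sup>2 - (y - lin_pred \<phi> \<theta> x)\<^sup>2))))" "\<lambda>_. borel"]
    by (simp add: gap_def)
  have "(\<integral>\<^sup>+\<omega>. ennreal (exp (lam * (s * (emp \<omega> \<theta>bar - emp \<omega> \<theta>)))) \<partial>M) = (\<integral>\<^sup>+\<omega>. (\<Prod>i = 1..n. ?E i \<omega>) \<partial>M)"
  proof (intro nn_integral_cong)
    fix \<omega>
    have "lam * (s * (emp \<omega> \<theta>bar - emp \<omega> \<theta>)) = ?z * (s * (\<Sum>i = 1..n. gap \<theta> i \<omega>))"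
      unfolding sum_gap by simp
    also have "\<dots> = (\<Sum>i = 1..n. ?z * (s * gap \<theta> i \<omega>))"
      by (simp only: sum_distrib_left)
    finally show "ennreal (exp (lam * (s * (emp \<omega> \<theta>bar - emp \<omega> \<theta>)))) = (\<Prod>i = 1..n. ?E i \<omega>)"
      by (simp only: exp_sum finite_atLeastAtMost prod_ennreal exp_ge_zero)
  qed
  also have "\<dots> = (\<Prod>i = 1..n. \<integral>\<^sup>+\<omega>. ?E i \<omega> \<partial>M)"
    by (intro indep_vars_nn_integral indep) auto
  also have "\<dots> \<le> (\<Prod>i = 1..n. ennreal (exp (?z * (s * expectation (gap \<theta> i) + coord_excess \<theta> i / 2))))"
    using gap_exp_moment[OF \<theta> _ s] by (intro prod_mono_ennreal) auto
  also have "\<dots> = ennreal (exp (\<Sum>i = 1..n. ?z * (s * expectation (gap \<theta> i) + coord_excess \<theta> i / 2)))"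
    by (simp only: exp_sum finite_atLeastAtMost prod_ennreal exp_ge_zero)
  also have "(\<Sum>i = 1..n. ?z * (s * expectation (gap \<theta> i) + coord_excess \<theta> i / 2))
      = ?z * (s * (\<Sum>i = 1..n. expectation (gap \<theta> i)) + (\<Sum>i = 1..n. coord_excess \<theta> i) / 2)"
    by (simp only: sum_distrib_left[symmetric] sum.distrib sum_divide_distrib)
  also have "\<dots> = lam * (excess \<theta> / 2 - s * excess \<theta>)"
    unfolding sum_expectation_gap sum_coord_excess by (simp add: algebra_simps add_divide_distrib diff_divide_distrib)
  finally show ?thesis .
qed

text \<open>The two signs \<open>s = 1\<close> and \<open>s = - 1\<close> of \<open>sum_gap_exp_moment\<close>: since the mean of the gap is minus the
excess, half of the excess is left over in one direction, and three halves are spent in the other.\<close>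
lemma excess_exp_moments:
  assumes \<theta>: "\<theta> \<in> Theta (K + 1) UNIV"
  shows "(\<integral>\<^sup>+\<omega>. ennreal (exp (lam * (excess \<theta> / 2 - (emp \<omega> \<theta> - emp \<omega> \<theta>bar)))) \<partial>M) \<le> 1"
    and "(\<integral>\<^sup>+\<omega>. ennreal (exp (lam * ((emp \<omega> \<theta> - emp \<omega> \<theta>bar) - 3 / 2 * excess \<theta>))) \<partial>M) \<le> 1"
proof -
  have shift: "(\<integral>\<^sup>+\<omega>. ennreal (exp (lam * (s * (emp \<omega> \<theta>bar - emp \<omega> \<theta>) + (s * excess \<theta> - excess \<theta> / 2)))) \<partial>M) \<le> 1"
    if "\<bar>s\<bar> = 1" for s
  proof -
    let ?c = "exp (lam * (s * excess \<theta> - excess \<theta> / 2))"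
    have "(\<lambda>\<omega>. emp \<omega> a) \<in> borel_measurable M" for a
      using measurable_compose[OF sample_measurable[OF X_meas Y_meas] emp_risk_measurable[OF \<phi>_meas]] .
    then have meas: "(\<lambda>\<omega>. ennreal (exp (lam * (s * (emp \<omega> \<theta>bar - emp \<omega> \<theta>))))) \<in> borel_measurable M"
      by measurable
    have "(\<integral>\<^sup>+\<omega>. ennreal (exp (lam * (s * (emp \<omega> \<theta>bar - emp \<omega> \<theta>) + (s * excess \<theta> - excess \<theta> / 2)))) \<partial>M)
        = (\<integral>\<^sup>+\<omega>. ennreal ?c * ennreal (exp (lam * (s * (emp \<omega> \<theta>bar - emp \<omega> \<theta>)))) \<partial>M)"
      by (intro nn_integral_cong) (simp add: ennreal_mult[symmetric] exp_add[symmetric] algebra_simps)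
    also have "\<dots> = ennreal ?c * (\<integral>\<^sup>+\<omega>. ennreal (exp (lam * (s * (emp \<omega> \<theta>bar - emp \<omega> \<theta>)))) \<partial>M)"
      using meas by (rule nn_integral_cmult)
    also have "\<dots> \<le> ennreal ?c * ennreal (exp (lam * (excess \<theta> / 2 - s * excess \<theta>)))"
      using sum_gap_exp_moment[OF \<theta> that] by (rule mult_left_mono) simp
    also have "\<dots> = 1"
      by (simp add: ennreal_mult[symmetric] exp_add[symmetric] algebra_simps)
    finally show ?thesis .
  qed
  show "(\<integral>\<^sup>+\<omega>. ennreal (exp (lam * (excess \<theta> / 2 - (emp \<omega> \<theta> - emp \<omega> \<theta>bar)))) \<partial>M) \<le> 1"
    using shift[of 1] by (simp add: algebra_simps)
  show "(\<integral>\<^sup>+\<omega>. ennreal (exp (lam * ((emp \<omega> \<theta> - emp \<omega> \<theta>bar) - 3 / 2 * excess \<theta>))) \<partial>M) \<le> 1"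
    using shift[of "- 1"] by (simp add: algebra_simps)
qed

section \<open>The oracle inequality in the regression model\<close>

lemma excess_le: "0 \<le> excess \<theta>" "excess \<theta> \<le> (L * l1_norm (\<theta> - \<theta>bar))\<^sup>2"
proof -
  have le: "(lin_pred \<phi> (\<theta> - \<theta>bar) (X i \<omega>))\<^sup>2 \<le> (L * l1_norm (\<theta> - \<theta>bar))\<^sup>2"
    if "i \<in> {1..n}" "\<omega> \<in> space M" for i \<omega>
    using power_mono[OF lin_pred_le[OF X_space[OF that], of "\<theta> - \<theta>bar"], of 2] by simp
  show "0 \<le> excess \<theta>"
    unfolding excess_def by (intro Bochner_Integration.integral_nonneg mult_nonneg_nonneg sum_nonneg) auto
  have "coord_excess \<theta> i \<le> (L * l1_norm (\<theta> - \<theta>bar))\<^sup>2" if "i \<in> {1..n}" for i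
    unfolding coord_excess_def
    using lin_pred_sq_integrable[OF that, of "\<theta> - \<theta>bar" "\<theta> - \<theta>bar"] le[OF that]
    by (intro integral_le_const) (auto simp: power2_eq_square)
  then have "real n * excess \<theta> \<le> real n * (L * l1_norm (\<theta> - \<theta>bar))\<^sup>2"
    unfolding sum_coord_excess[symmetric]
    using sum_bounded_above[of "{1..n}" "coord_excess \<theta>" "(L * l1_norm (\<theta> - \<theta>bar))\<^sup>2"] by simp
  then show "excess \<theta> \<le> (L * l1_norm (\<theta> - \<theta>bar))\<^sup>2"
    using n by simp
qed

lemma excess_le_D: "\<theta> \<in> Theta (K + 1) UNIV \<Longrightarrow> excess \<theta> \<le> D\<^sup>2"
proof -
  assume "\<theta> \<in> Theta (K + 1) UNIV"
  then have "l1_norm (\<theta> - \<theta>bar) \<le> 2 * K + 1"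
    using l1_norm_diff_le[of \<theta> \<theta>bar] \<theta>bar_K by (simp add: Theta_UNIV)
  then have "(L * l1_norm (\<theta> - \<theta>bar))\<^sup>2 \<le> D\<^sup>2"
    using L l1_norm_nonneg[of "\<theta> - \<theta>bar"] by (intro power_mono mult_left_mono mult_nonneg_nonneg) auto
  then show ?thesis using excess_le(2)[of \<theta>] by simp
qed

lemma excess_measurable: "excess \<in> borel_measurable borel"
proof -
  have [measurable]: "(\<lambda>\<omega>. \<phi> j (X i \<omega>)) \<in> borel_measurable M" if "i \<in> {1..n}" for i j
    using measurable_compose[OF X_meas[OF that] \<phi>_meas] .
  show ?thesis
    unfolding excess_def[abs_def] lin_pred_def
    by (intro borel_measurable_lebesgue_integral, unfold split_beta')
       (intro borel_measurable_times borel_measurable_const borel_measurable_sum borel_measurable_power; measurable)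
qed

text \<open>The supporting hyperplane of the quadratic form comes from \<open>u\<^sup>2 + 2 u v \<le> (u + v)\<^sup>2\<close>, applied at
each design point.\<close>
lemma excess_support:
  "\<exists>l. bounded_linear l \<and> (\<forall>\<theta>. excess a + l (\<theta> - a) \<le> excess \<theta>)"
proof -
  define l where "l h = expectation (\<lambda>\<omega>. (2 / real n) *
    (\<Sum>i = 1..n. lin_pred \<phi> (a - \<theta>bar) (X i \<omega>) * lin_pred \<phi> h (X i \<omega>)))" for h
  have int: "integrable M (\<lambda>\<omega>. c / real n * (\<Sum>i = 1..n. lin_pred \<phi> u (X i \<omega>) * lin_pred \<phi> v (X i \<omega>)))" for c u v
    by (intro integrable_mult_right Bochner_Integration.integrable_sum lin_pred_sq_integrable)
  have "linear l"
  proof (rule linearI)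
    show "l (u + v) = l u + l v" for u v
      unfolding l_def Bochner_Integration.integral_add[OF int int, symmetric]
      by (simp add: lin_pred_add sum.distrib distrib_left add_divide_distrib)
    show "l (c *\<^sub>R u) = c *\<^sub>R l u" for c u
    proof -
      have "(2 / real n) * (\<Sum>i = 1..n. lin_pred \<phi> (a - \<theta>bar) (X i \<omega>) * lin_pred \<phi> (c *\<^sub>R u) (X i \<omega>))
          = c * ((2 / real n) * (\<Sum>i = 1..n. lin_pred \<phi> (a - \<theta>bar) (X i \<omega>) * lin_pred \<phi> u (X i \<omega>)))" for \<omega>
        by (simp add: lin_pred_scaleR sum_distrib_left mult_ac)
      then show ?thesis unfolding l_def by (simp only: integral_mult_right_zero real_scaleR_def)
    qed
  qed
  then have "bounded_linear l" by (simp add: linear_conv_bounded_linear)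
  moreover have "excess a + l (\<theta> - a) \<le> excess \<theta>" for \<theta>
  proof -
    have "excess a + l (\<theta> - a) = expectation (\<lambda>\<omega>.
        (1 / real n) * (\<Sum>i = 1..n. lin_pred \<phi> (a - \<theta>bar) (X i \<omega>) * lin_pred \<phi> (a - \<theta>bar) (X i \<omega>))
        + (2 / real n) * (\<Sum>i = 1..n. lin_pred \<phi> (a - \<theta>bar) (X i \<omega>) * lin_pred \<phi> (\<theta> - a) (X i \<omega>)))"
      unfolding l_def excess_def power2_eq_square by (rule Bochner_Integration.integral_add[OF int int, symmetric])
    also have "\<dots> \<le> excess \<theta>"
      unfolding excess_def power2_eq_square
    proof (intro integral_mono Bochner_Integration.integrable_add int)
      fix \<omega>
      let ?u = "\<lambda>i. lin_pred \<phi> (a - \<theta>bar) (X i \<omega>)" and ?v = "\<lambda>i. lin_pred \<phi> (\<theta> - a) (X i \<omega>)"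
        and ?w = "\<lambda>i. lin_pred \<phi> (\<theta> - \<theta>bar) (X i \<omega>)"
      have w: "?w i = ?u i + ?v i" for i by (simp add: lin_pred_diff)
      have "?u i * ?u i + 2 * (?u i * ?v i) \<le> ?w i * ?w i" for i
        unfolding w by (simp add: algebra_simps)
      then have "(\<Sum>i = 1..n. ?u i * ?u i + 2 * (?u i * ?v i)) \<le> (\<Sum>i = 1..n. ?w i * ?w i)"
        by (rule sum_mono)
      then have "(1 / real n) * (\<Sum>i = 1..n. ?u i * ?u i + 2 * (?u i * ?v i)) \<le> (1 / real n) * (\<Sum>i = 1..n. ?w i * ?w i)"
        by (rule mult_left_mono) simp
      then show "(1 / real n) * (\<Sum>i = 1..n. ?u i * ?u i) + (2 / real n) * (\<Sum>i = 1..n. ?u i * ?v i)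
          \<le> (1 / real n) * (\<Sum>i = 1..n. ?w i * ?w i)"
        by (simp add: sum.distrib sum_distrib_left[symmetric] add_divide_distrib)
    qed
    finally show ?thesis .
  qed
  ultimately show ?thesis by blast
qed

context
  fixes \<alpha> :: real
  assumes \<alpha>: "0 < \<alpha>" "\<alpha> < 1" and n_less: "n < CARD('p)" and K1: "1 < K"
begin

lemma K1_pos: "0 < K + 1"
  using K1 by simp

abbreviation "est \<omega> \<equiv> gibbs_est \<phi> n \<alpha> K lam (sample n X Y \<omega>)"

lemma excess_gibbs_est_le:
  "excess (gibbs_est \<phi> n \<alpha> K l z) \<le> (\<integral>\<theta>. excess \<theta> \<partial>gibbs \<phi> n \<alpha> K l z)"
  "(\<integral>\<theta>. excess \<theta> \<partial>gibbs \<phi> n \<alpha> K l z) \<le> D\<^sup>2"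
proof -
  let ?D = "gibbs \<phi> n \<alpha> K l z"
  interpret D: prob_space ?D by (rule prob_space_gibbs[OF \<alpha>(1) K1_pos n_less])
  note sets = sets_gibbs[OF \<alpha>(1) K1_pos n_less, of \<phi> l z]
  note ae = AE_gibbs_Theta[OF \<alpha>(1) K1_pos n_less, of \<phi> l z]
  have norm_le: "norm \<theta> \<le> l1_norm \<theta>" for \<theta> :: "real ^ 'p"
    unfolding l1_norm_def by (rule norm_le_l1_cart)
  have id_int: "integrable ?D (\<lambda>\<theta>. \<theta>)"
  proof (rule D.integrable_const_bound)
    show "AE \<theta> in ?D. norm \<theta> \<le> K + 1"
      using ae by eventually_elim (auto simp: Theta_UNIV intro: order_trans[OF norm_le])
  qed (simp add: measurable_ident_sets sets)
  have ex_int: "integrable ?D excess"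
  proof (rule D.integrable_const_bound)
    show "AE \<theta> in ?D. norm (excess \<theta>) \<le> D\<^sup>2"
      using ae by eventually_elim (simp add: excess_le excess_le_D)
  qed (use excess_measurable sets in \<open>simp cong: measurable_cong_sets\<close>)
  obtain h where "bounded_linear h"
    and "\<And>\<theta>. excess (D.expectation (\<lambda>\<theta>. \<theta>)) + h (\<theta> - D.expectation (\<lambda>\<theta>. \<theta>)) \<le> excess \<theta>"
    using excess_support by blast
  then have "excess (D.expectation (\<lambda>\<theta>. \<theta>)) \<le> D.expectation (\<lambda>\<theta>. excess \<theta>)"
    using id_int ex_int by (intro D.supporting_hyperplane_mean)
  then show "excess (gibbs_est \<phi> n \<alpha> K l z) \<le> (\<integral>\<theta>. excess \<theta> \<partial>?D)"
    unfolding gibbs_est_eq_mean[OF \<alpha>(1) K1_pos n_less] .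
  show "(\<integral>\<theta>. excess \<theta> \<partial>?D) \<le> D\<^sup>2"
    using ae by (intro D.integral_le_const[OF ex_int]) (auto elim: eventually_mono intro: excess_le_D)
qed

lemma est_measurable: "est \<in> borel_measurable M"
  using measurable_compose[OF sample_measurable[OF X_meas Y_meas]
      gibbs_est_measurable[OF \<alpha>(1) K1_pos n_less \<phi>_meas]] .

lemma int_risk_est_measurable: "(\<lambda>\<omega>. R (est \<omega>)) \<in> borel_measurable M"
proof -
  have "(\<lambda>\<omega>. R \<theta>bar + excess (est \<omega>)) \<in> borel_measurable M"
    using measurable_compose[OF est_measurable excess_measurable] by simp
  then show ?thesis by (subst int_risk_eq_excess)
qed

lemma emp_measurable_pair:
  assumes m: "sets m = sets borel"
  shows "(\<lambda>(\<omega>, \<theta>). emp \<omega> \<theta>) \<in> borel_measurable (M \<Otimes>\<^sub>M m)"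
proof -
  have "(\<lambda>p. (sample n X Y (fst p), snd p)) \<in> measurable (M \<Otimes>\<^sub>M m) (sample_space N n \<Otimes>\<^sub>M borel)"
  proof (intro measurable_Pair)
    show "(\<lambda>p. sample n X Y (fst p)) \<in> measurable (M \<Otimes>\<^sub>M m) (sample_space N n)"
      by (rule measurable_compose[OF measurable_fst sample_measurable[OF X_meas Y_meas]])
    show "snd \<in> measurable (M \<Otimes>\<^sub>M m) borel"
      using measurable_snd[of M m] by (simp add: measurable_cong_sets[OF refl m])
  qed
  from measurable_compose[OF this emp_risk_measurable_pair[OF \<phi>_meas, where n = n]] show ?thesis
    by (simp add: split_beta')
qed

lemma high_prob_moments:
  assumes m: "prob_space m" and sets_m: "sets m = sets borel"
    and ae: "AE \<theta> in m. \<theta> \<in> Theta (K + 1) UNIV" and \<delta>: "0 < \<delta>"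
  shows "{\<omega> \<in> space M. \<not> (\<integral>\<^sup>+\<theta>. ennreal (exp (lam * (excess \<theta> / 2 - (emp \<omega> \<theta> - emp \<omega> \<theta>bar)))) \<partial>m)
      \<le> ennreal (1 / \<delta>)} \<in> events \<and>
    prob {\<omega> \<in> space M. \<not> (\<integral>\<^sup>+\<theta>. ennreal (exp (lam * (excess \<theta> / 2 - (emp \<omega> \<theta> - emp \<omega> \<theta>bar)))) \<partial>m)
      \<le> ennreal (1 / \<delta>)} \<le> \<delta>" (is ?upper)
    and "{\<omega> \<in> space M. \<not> (\<integral>\<^sup>+\<theta>. ennreal (exp (lam * ((emp \<omega> \<theta> - emp \<omega> \<theta>bar) - 3 / 2 * excess \<theta>))) \<partial>m)
      \<le> ennreal (1 / \<delta>)} \<in> events \<and>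
    prob {\<omega> \<in> space M. \<not> (\<integral>\<^sup>+\<theta>. ennreal (exp (lam * ((emp \<omega> \<theta> - emp \<omega> \<theta>bar) - 3 / 2 * excess \<theta>))) \<partial>m)
      \<le> ennreal (1 / \<delta>)} \<le> \<delta>" (is ?lower)
proof -
  note [measurable_cong] = sets_m
  note [measurable] = excess_measurable emp_measurable_pair[OF sets_m]
  have [measurable]: "(\<lambda>\<omega>. emp \<omega> \<theta>bar) \<in> borel_measurable M"
    using measurable_compose[OF sample_measurable[OF X_meas Y_meas] emp_risk_measurable[OF \<phi>_meas]] .
  have "(\<lambda>(\<omega>, \<theta>). lam * (excess \<theta> / 2 - (emp \<omega> \<theta> - emp \<omega> \<theta>bar))) \<in> borel_measurable (M \<Otimes>\<^sub>M m)"
    by measurable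
  moreover have "AE \<theta> in m. (\<integral>\<^sup>+\<omega>. ennreal (exp (lam * (excess \<theta> / 2 - (emp \<omega> \<theta> - emp \<omega> \<theta>bar)))) \<partial>M) \<le> 1"
    using ae by eventually_elim (rule excess_exp_moments(1))
  ultimately show ?upper
    using mixture_exp_moment_high_prob[OF prob_space_axioms m _ _ \<delta>,
        where h = "\<lambda>(\<omega>, \<theta>). lam * (excess \<theta> / 2 - (emp \<omega> \<theta> - emp \<omega> \<theta>bar))"]
    by (simp only: prod.case)
  have "(\<lambda>(\<omega>, \<theta>). lam * ((emp \<omega> \<theta> - emp \<omega> \<theta>bar) - 3 / 2 * excess \<theta>)) \<in> borel_measurable (M \<Otimes>\<^sub>M m)"
    by measurable
  moreover have "AE \<theta> in m. (\<integral>\<^sup>+\<omega>. ennreal (exp (lam * ((emp \<omega> \<theta> - emp \<omega> \<theta>bar) - 3 / 2 * excess \<theta>))) \<partial>M) \<le> 1"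
    using ae by eventually_elim (rule excess_exp_moments(2))
  ultimately show ?lower
    using mixture_exp_moment_high_prob[OF prob_space_axioms m _ _ \<delta>,
        where h = "\<lambda>(\<omega>, \<theta>). lam * ((emp \<omega> \<theta> - emp \<omega> \<theta>bar) - 3 / 2 * excess \<theta>)"]
    by (simp only: prod.case)
qed


text \<open>If the support of \<open>\<theta>bar\<close> has more than \<open>n\<close> elements, the bound holds everywhere, because its
remainder term exceeds the largest excess risk on the \<open>\<ell>\<^sub>1\<close> ball. Otherwise the two exponential integrals are
controlled, each up to probability \<open>\<epsilon> / 2\<close>, and the deterministic bound applies. The complexity
\<open>- ln (m S)\<close> enters with factor \<open>2 / \<lambda> = 4 * C1 / n\<close> and \<open>ln (2 / \<epsilon>)\<close> with twice that, so both
are covered by \<open>8 * C1 / n\<close>.\<close>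
theorem gibbs_oracle_inequality:
  assumes \<epsilon>: "0 < \<epsilon>" "\<epsilon> < 1"
  shows "prob {\<omega> \<in> space M. R (est \<omega>) \<le> R \<theta>bar + 3 * L\<^sup>2 / (real n)\<^sup>2
    + 8 * C1 / real n * (real (card (supp \<theta>bar)) * ln (K + 1)
      + (real (card (supp \<theta>bar)) * ln (exp 1 * real n * real CARD('p) / (\<alpha> * real (card (supp \<theta>bar))))
        + ln (2 / (\<epsilon> * (1 - \<alpha>)))))} \<ge> 1 - \<epsilon>" (is "prob {\<omega> \<in> space M. R (est \<omega>) \<le> ?bound} \<ge> _")
proof -
  let ?k = "card (supp \<theta>bar)" and ?p = "CARD('p)"
  define U where "U = real ?k * ln (K + 1) + real ?k * ln (exp 1 * real n * real ?p / (\<alpha> * real ?k))"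
  have ln_split: "ln (2 / (\<epsilon> * (1 - \<alpha>))) = ln (2 / \<epsilon>) + ln (1 / (1 - \<alpha>))"
    using \<epsilon> \<alpha> by (simp add: ln_div ln_mult)
  have bound_eq: "?bound = R \<theta>bar + 3 * L\<^sup>2 / (real n)\<^sup>2 + 8 * C1 / real n * (U + ln (1 / (1 - \<alpha>)) + ln (2 / \<epsilon>))"
    unfolding U_def ln_split by (simp add: algebra_simps)
  have ln_pos: "0 \<le> ln (2 / \<epsilon>)" "0 \<le> ln (1 / (1 - \<alpha>))"
    using \<epsilon> \<alpha> by auto
  have C1n: "0 \<le> 8 * C1 / real n"
    using C1_ge(4) by simp
  show ?thesis
  proof (cases "?k \<le> n")
    case False
    have p_ge: "?k \<le> ?p" by (simp add: card_mono)
    have "\<alpha> * real ?k \<le> real n * real ?p"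
    proof (rule mult_mono)
      show "\<alpha> \<le> real n" using \<alpha> n by simp
    qed (use p_ge in auto)
    then have "exp 1 \<le> exp 1 * real n * real ?p / (\<alpha> * real ?k)"
      using False \<alpha> by (simp add: pos_le_divide_eq)
    then have "1 \<le> ln (exp 1 * real n * real ?p / (\<alpha> * real ?k))"
      using ln_mono[of "exp 1"] by fastforce
    then have "real ?k * 1 \<le> real ?k * ln (exp 1 * real n * real ?p / (\<alpha> * real ?k))"
      by (rule mult_left_mono) simp
    moreover have "0 \<le> real ?k * ln (K + 1)"
      using K1 by simp
    ultimately have "real n \<le> U + ln (1 / (1 - \<alpha>)) + ln (2 / \<epsilon>)"
      using False ln_pos unfolding U_def by linarith
    then have "8 * C1 / real n * real n \<le> 8 * C1 / real n * (U + ln (1 / (1 - \<alpha>)) + ln (2 / \<epsilon>))"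
      using C1n by (rule mult_left_mono)
    then have big: "C1 \<le> 8 * C1 / real n * (U + ln (1 / (1 - \<alpha>)) + ln (2 / \<epsilon>))"
      using n C1_ge(4) by simp
    have "R (est \<omega>) \<le> ?bound" for \<omega>
    proof -
      have "excess (est \<omega>) \<le> C1"
        using excess_gibbs_est_le[of lam "sample n X Y \<omega>"] C1_ge(3) by linarith
      moreover have "0 \<le> 3 * L\<^sup>2 / (real n)\<^sup>2" by simp
      ultimately show ?thesis
        unfolding bound_eq int_risk_eq_excess[of "est \<omega>"] using big by linarith
    qed
    then show ?thesis
      using \<epsilon> prob_space by simp
  next
    case True
    let ?m = "prior \<alpha> n K :: (real ^ 'p) measure"
    let ?S = "{\<theta>. l1_norm (\<theta> - \<theta>bar) \<le> 1 / real n}"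
    interpret m: prob_space ?m by (rule prob_space_prior[OF \<alpha>(1) K1_pos n_less])
    have S_sets: "?S \<in> sets ?m" by (simp add: sets_prior l1_nbhd_sets)
    have room: "l1_norm \<theta>bar + 1 / real n \<le> K + 1"
      using \<theta>bar_K n by (simp add: add_mono divide_le_eq)
    let ?u = "(1 / real n / (K + 1)) ^ ?k" and ?w = "prior_weight \<alpha> n (supp \<theta>bar)"
    have u: "0 < ?u" using n K1 by simp
    have "emeasure (unif (K + 1) (supp \<theta>bar)) ?S = ennreal ?u"
      using n by (intro emeasure_unif_l1_nbhd K1_pos room) (auto simp: supp_def)
    then have mS: "?w * ?u \<le> measure ?m ?S"
      using u by (intro measure_prior_ge[OF \<alpha>(1) K1_pos n_less l1_nbhd_sets]) auto
    note w = neg_ln_prior_weight_le[OF \<alpha> True]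
    have mS_pos: "0 < measure ?m ?S"
      using mS w(1) u by (meson mult_pos_pos less_le_trans)
    have neg_ln_mS: "- ln (measure ?m ?S) \<le> U + ln (1 / (1 - \<alpha>))"
    proof -
      have "ln (?w * ?u) \<le> ln (measure ?m ?S)"
        using mS w(1) u mS_pos by (subst ln_le_cancel_iff) auto
      moreover have "ln (?w * ?u) = ln ?w - real ?k * ln (real n) - real ?k * ln (K + 1)"
      proof -
        have "ln (1 / real n / (K + 1)) = - ln (real n) - ln (K + 1)"
          using n K1 by (simp only: ln_div) (simp add: ln_div)
        then have "ln ?u = real ?k * (- ln (real n) - ln (K + 1))"
          using n K1 by (subst ln_realpow) auto
        moreover have "ln (?w * ?u) = ln ?w + ln ?u"
          using w(1) u by (intro ln_mult_pos)
        ultimately show ?thesis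
          by (simp only: right_diff_distrib mult_minus_right)
      qed
      moreover have "real ?k * ln (exp 1 * real ?p / (\<alpha> * real ?k)) + real ?k * ln (real n)
          = real ?k * ln (exp 1 * real n * real ?p / (\<alpha> * real ?k))"
        using \<alpha> n by (cases "?k = 0") (auto simp: ln_mult ln_div algebra_simps)
      ultimately show ?thesis
        using w(2) unfolding U_def by linarith
    qed
    have U_nonneg: "0 \<le> U + ln (1 / (1 - \<alpha>))"
      using neg_ln_mS mS_pos m.prob_le_1[of ?S] by (smt (verit) ln_le_zero_iff)
    let ?P = "uniform_measure ?m ?S"
    have ae: "AE \<theta> in ?m. \<theta> \<in> Theta (K + 1) UNIV"
      by (rule AE_prior_Theta[OF \<alpha>(1) K1_pos n_less])
    have P: "prob_space ?P"
      using mS_pos by (intro prob_space_uniform_measure) (auto simp: m.emeasure_eq_measure)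
    have ae_P: "AE \<theta> in ?P. \<theta> \<in> Theta (K + 1) UNIV"
      using ae S_sets by (intro AE_uniform_measureI) auto
    have sets_P: "sets ?P = sets borel" by (simp add: sets_prior)
    let ?A = "\<lambda>\<omega>. \<integral>\<^sup>+\<theta>. ennreal (exp (lam * (excess \<theta> / 2 - (emp \<omega> \<theta> - emp \<omega> \<theta>bar)))) \<partial>?m"
    let ?B = "\<lambda>\<omega>. \<integral>\<^sup>+\<theta>. ennreal (exp (lam * ((emp \<omega> \<theta> - emp \<omega> \<theta>bar) - 3 / 2 * excess \<theta>))) \<partial>?P"
    have good: "R (est \<omega>) \<le> ?bound"
      if A: "?A \<omega> \<le> ennreal (1 / (\<epsilon> / 2))" and B: "?B \<omega> \<le> ennreal (1 / (\<epsilon> / 2))" for \<omega>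
    proof -
      let ?z = "sample n X Y \<omega>"
      obtain Br where Br: "AE t in ?m. \<bar>emp \<omega> t\<bar> \<le> Br"
        by (rule AE_emp_risk_bounded[OF \<alpha>(1) K1_pos n_less, of \<phi> ?z])
      have "(\<integral>\<theta>. excess \<theta> \<partial>gibbs \<phi> n \<alpha> K lam ?z)
          \<le> 3 * (L\<^sup>2 / (real n)\<^sup>2) + 2 / lam * (ln (1 / (\<epsilon> / 2)) + ln (1 / (\<epsilon> / 2)) - ln (measure ?m ?S))"
        unfolding gibbs_eq[OF \<alpha>(1) K1_pos n_less]
      proof (rule gibbs_mean_excess_le[OF m.prob_space_axioms _ _ Br _ _ S_sets mS_pos _ _ _ A B])
        show "emp \<omega> \<in> borel_measurable ?m" "excess \<in> borel_measurable ?m"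
          using emp_risk_measurable_coeff[of \<phi> n ?z] excess_measurable
          by (simp_all add: measurable_cong_sets[OF sets_prior refl])
        show "AE t in ?m. \<bar>excess t\<bar> \<le> D\<^sup>2"
          using ae by eventually_elim (simp add: excess_le excess_le_D)
        show "0 < lam" using n C1_ge(4) by simp
        show "excess t \<le> L\<^sup>2 / (real n)\<^sup>2" if "t \<in> ?S" for t
        proof -
          have "(L * l1_norm (t - \<theta>bar))\<^sup>2 \<le> (L * (1 / real n))\<^sup>2"
            using that L l1_norm_nonneg by (intro power_mono mult_left_mono mult_nonneg_nonneg) auto
          then show ?thesis
            using excess_le(2)[of t] by (simp add: power_mult_distrib power_divide)
        qed
      qed (use \<epsilon> in auto)
      also have "\<dots> \<le> 3 * L\<^sup>2 / (real n)\<^sup>2 + 8 * C1 / real n * (U + ln (1 / (1 - \<alpha>)) + ln (2 / \<epsilon>))"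
      proof -
        have "ln (1 / (\<epsilon> / 2)) + ln (1 / (\<epsilon> / 2)) - ln (measure ?m ?S)
            \<le> 2 * (U + ln (1 / (1 - \<alpha>)) + ln (2 / \<epsilon>))"
          using neg_ln_mS U_nonneg by simp
        then have "2 / lam * (ln (1 / (\<epsilon> / 2)) + ln (1 / (\<epsilon> / 2)) - ln (measure ?m ?S))
            \<le> 2 / lam * (2 * (U + ln (1 / (1 - \<alpha>)) + ln (2 / \<epsilon>)))"
          using C1_ge(4) by (intro mult_left_mono) auto
        also have "\<dots> = 8 * C1 / real n * (U + ln (1 / (1 - \<alpha>)) + ln (2 / \<epsilon>))"
        proof -
          have "2 / lam * (2 * x) = 8 * C1 / real n * x" for x
            by simp
          then show ?thesis .
        qed
        finally show ?thesis by linarith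
      qed
      finally show ?thesis
        unfolding bound_eq int_risk_eq_excess[of "est \<omega>"]
        using excess_gibbs_est_le(1)[of lam ?z] by linarith
    qed
    let ?NA = "{\<omega> \<in> space M. \<not> ?A \<omega> \<le> ennreal (1 / (\<epsilon> / 2))}"
    let ?NB = "{\<omega> \<in> space M. \<not> ?B \<omega> \<le> ennreal (1 / (\<epsilon> / 2))}"
    let ?G = "{\<omega> \<in> space M. R (est \<omega>) \<le> ?bound}"
    have G: "?G \<in> events"
      using int_risk_est_measurable by measurable
    have half: "0 < \<epsilon> / 2"
      using \<epsilon> by simp
    note NA = high_prob_moments(1)[OF m.prob_space_axioms sets_prior ae half]
    note NB = high_prob_moments(2)[OF P sets_P ae_P half]
    have "space M - ?G \<subseteq> ?NA \<union> ?NB"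
      using good by blast
    then have "prob (space M - ?G) \<le> prob (?NA \<union> ?NB)"
      by (rule finite_measure_mono[OF _ sets.Un[OF conjunct1[OF NA] conjunct1[OF NB]]])
    also have "\<dots> \<le> prob ?NA + prob ?NB"
      by (rule measure_Un_le[OF conjunct1[OF NA] conjunct1[OF NB]])
    also have "\<dots> \<le> \<epsilon> / 2 + \<epsilon> / 2"
      by (rule add_mono[OF conjunct2[OF NA] conjunct2[OF NB]])
    finally show ?thesis
      using prob_compl[OF G] by simp
  qed
qed

end

end

section \<open>The oracle inequality for the sparse Gibbs estimator\<close>

theorem theorem3p1:
  fixes M :: "'w measure" and N :: "'x measure"
    and n :: nat
    and X :: "nat \<Rightarrow> 'w \<Rightarrow> 'x" and Y W :: "nat \<Rightarrow> 'w \<Rightarrow> real"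
    and f :: "'x \<Rightarrow> real" and \<phi> :: "'p::finite \<Rightarrow> 'x \<Rightarrow> real"
    and \<sigma> \<xi> \<alpha> K L C1 \<epsilon> :: real
    and \<theta>bar :: "real ^ 'p"
  defines "L \<equiv> Max (range (\<lambda>j. sup_norm N (\<phi> j)))"
    and "C1 \<equiv> C1_const \<sigma> \<xi> (sup_norm N f) L K"
  assumes "prob_space M"
    and "n \<ge> 1" and "CARD('p) > n"
    and X_meas: "\<And>i. i \<in> {1..n} \<Longrightarrow> X i \<in> measurable M N"
    and W_meas: "\<And>i. i \<in> {1..n} \<Longrightarrow> W i \<in> borel_measurable M"
    and f_meas: "f \<in> borel_measurable N" and f_bdd: "bounded (f ` space N)"
    and Y_eq: "\<And>i \<omega>. i \<in> {1..n} \<Longrightarrow> \<omega> \<in> space M \<Longrightarrow> Y i \<omega> = f (X i \<omega>) + W i \<omega>"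
    and pairs_indep:
      "prob_space.indep_vars M (\<lambda>_. N \<Otimes>\<^sub>M borel) (\<lambda>i \<omega>. (X i \<omega>, Y i \<omega>)) {1..n}"
    and W_indep: "prob_space.indep_vars M (\<lambda>_. borel) W {1..n}"
    and W_indep_X:
      "prob_space.indep_set M
         (sets (vimage_algebra (space M) (\<lambda>\<omega>. \<lambda>i\<in>{1..n}. W i \<omega>) (Pi\<^sub>M {1..n} (\<lambda>_. borel))))
         (sets (vimage_algebra (space M) (\<lambda>\<omega>. \<lambda>i\<in>{1..n}. X i \<omega>) (Pi\<^sub>M {1..n} (\<lambda>_. N))))"
    and "\<sigma> > 0" and "\<xi> > 0"
    and W_mean: "\<And>i. i \<in> {1..n} \<Longrightarrow> integrable M (W i) \<and> (\<integral>\<omega>. W i \<omega> \<partial>M) = 0"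
    and W_var: "\<And>i. i \<in> {1..n} \<Longrightarrow>
      integrable M (\<lambda>\<omega>. (W i \<omega>)\<^sup>2) \<and> (\<integral>\<omega>. (W i \<omega>)\<^sup>2 \<partial>M) \<le> \<sigma>\<^sup>2"
    and W_mom: "\<And>i k. i \<in> {1..n} \<Longrightarrow> k \<ge> 3 \<Longrightarrow>
      integrable M (\<lambda>\<omega>. \<bar>W i \<omega>\<bar> ^ k) \<and>
      (\<integral>\<omega>. \<bar>W i \<omega>\<bar> ^ k \<partial>M) \<le> \<sigma>\<^sup>2 * fact k * \<xi> ^ (k - 2)"
    and \<phi>_meas: "\<And>j. \<phi> j \<in> borel_measurable N"
    and \<phi>_norm: "\<And>j. design_norm M n X (\<phi> j) = 1"
    and \<phi>_bdd: "\<And>j. bounded (\<phi> j ` space N)"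
    and "0 < \<alpha>" and "\<alpha> < 1" and "K > 1"
    and argmin_ne:
      "{\<theta>. is_arg_min (int_risk M N \<phi> n X Y) (\<lambda>_. True) \<theta>} \<inter> Theta K UNIV \<noteq> {}"
    and "0 < \<epsilon>" and "\<epsilon> < 1"
    and \<theta>bar: "\<theta>bar \<in> {\<theta>. is_arg_min (int_risk M N \<phi> n X Y) (\<lambda>_. True) \<theta>} \<inter> Theta K UNIV"
  shows "measure M {\<omega> \<in> space M.
      int_risk M N \<phi> n X Y (gibbs_est \<phi> n \<alpha> K (real n / (2 * C1)) (sample n X Y \<omega>))
      \<le> int_risk M N \<phi> n X Y \<theta>bar + 3 * L\<^sup>2 / (real n)\<^sup>2
         + 8 * C1 / real n *
           (real (card (supp \<theta>bar)) * ln (K + 1)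
            + (real (card (supp \<theta>bar)) *
                 ln (exp 1 * real n * real CARD('p) / (\<alpha> * real (card (supp \<theta>bar))))
               + ln (2 / (\<epsilon> * (1 - \<alpha>)))))}
    \<ge> 1 - \<epsilon>"
proof -
  interpret prob_space M by fact
  obtain \<omega>0 where "\<omega>0 \<in> space M"
    using not_empty by auto
  then have x0: "X 1 \<omega>0 \<in> space N"
    using measurable_space[OF X_meas[of 1]] \<open>n \<ge> 1\<close> by auto
  have sup_norm_ge: "\<bar>g x\<bar> \<le> sup_norm N g" if "bounded (g ` space N)" "x \<in> space N" for g x
  proof -
    obtain a where "\<And>y. y \<in> space N \<Longrightarrow> \<bar>g y\<bar> \<le> a"
      using \<open>bounded (g ` space N)\<close> by (auto simp: bounded_iff)
    then have "bdd_above ((\<lambda>y. \<bar>g y\<bar>) ` space N)"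
      by (rule bdd_aboveI2)
    with \<open>x \<in> space N\<close> show ?thesis
      unfolding sup_norm_def by (rule cSUP_upper)
  qed
  have \<phi>_le: "\<bar>\<phi> j x\<bar> \<le> L" if "x \<in> space N" for j x
  proof -
    have "sup_norm N (\<phi> j) \<le> L"
      unfolding L_def by (rule Max_ge) auto
    then show ?thesis
      using sup_norm_ge[OF \<phi>_bdd that, of j] by linarith
  qed
  have min: "int_risk M N \<phi> n X Y \<theta>bar \<le> int_risk M N \<phi> n X Y \<theta>" for \<theta>
    using \<theta>bar by (auto simp: is_arg_min_linorder)
  have L_nonneg: "0 \<le> L"
    using \<phi>_le[OF x0] abs_ge_zero order_trans by blast
  have K_nonneg: "0 \<le> K"
    using \<open>K > 1\<close> by simp
  have \<theta>bar_K: "l1_norm \<theta>bar \<le> K"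
    using \<theta>bar by (simp add: Theta_UNIV)
  interpret sparse_regression M N n X Y W f \<phi> \<sigma> \<xi> "sup_norm N f" L K \<theta>bar
    by (unfold_locales; fact assms sup_norm_ge[OF f_bdd] \<phi>_le min L_nonneg K_nonneg \<theta>bar_K)
  show ?thesis
    unfolding C1_def
    using \<open>0 < \<alpha>\<close> \<open>\<alpha> < 1\<close> \<open>CARD('p) > n\<close> \<open>K > 1\<close> \<open>0 < \<epsilon>\<close> \<open>\<epsilon> < 1\<close>
    by (rule gibbs_oracle_inequality)
qed

end
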